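(* Let $n=2m$ with $m\ge 2$. The complete set of orthogonal idempotents for $MM(D_{2n})$ consists of the following $m+1$ matrices: $$U_{triv}=\frac1n\,J,$$ corresponding to the trivial representation; the matrix $U_{\chi'}$ whose $(a,b)$ entry is $\frac1n(-1)^{a+b}$ for $1\le a,b\le n$, corresponding to the character $\chi'$; and, for each $1\le j\le m-1$, corresponding to $\pi_2^j$, $$U_{\pi_2^j}=\frac2n\sum_{k=0}^{n-1}\cos(2kj\pi/n)\,P_{R^k},$$ that is, the matrix whose $(a,b)$ entry is $\frac2n\cos(2(a-b)j\pi/n)$.
   Context: $D_{2n}$ is the dihedral group with $2n$ elements, realized as the subgroup of the symmetric group $S_n$ generated by the $n$-cycle $R=(1\,2\,\dots\,n)$ and the involution $C$ given by $C(i)=n+1-i$; its elements are $R^k$ and $CR^k$, $0\le k<n$. For $\sigma\in S_n$, $P_\sigma$ is the $n\times n$ permutation matrix with $[P_\sigma]_{ji}=1$ if $\sigma(i)=j$ and $0$ otherwise. $MM(D_{2n})\subseteq M(n,\mathbb{C})$ is the associative algebra over $\mathbb{C}$ generated by the $P_\sigma$, $\sigma\in D_{2n}$ (equivalently, their complex linear span). $J$ is the $n\times n$ matrix with all entries $1$. $\chi_{det}$ is the one-dimensional character of $D_{2n}$ with $\chi_{det}(R^k)=1$, $\chi_{det}(CR^k)=-1$; $\chi_{sgn}(\sigma)=\det(P_\sigma)$; $\chi'=\chi_{sgn}$ if $m$ is odd, and $\chi'=\chi_{det}\cdot\chi_{sgn}$ if $m$ is even. $\pi_2$ is the two-dimensional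 complex representation of $D_{2n}$ in which $R$ acts as rotation by $2\pi/n$ and $C$ as reflection across the $x$-axis on $\mathbb{R}^2$, extended to $\mathbb{C}^2$; $\pi_2^j=\pi_2\circ\varphi_j$, where $\varphi_j:D_{2n}\to D_{2n}$ is the homomorphism with $\varphi_j(R)=R^j$, $\varphi_j(C)=C$. $MM(D_{2n})$ is a semisimple algebra, hence the direct sum of its simple two-sided ideals; each of them is, under the action $(g_1,g_2)M=P_{g_1}MP_{g_2}^{-1}$ of $D_{2n}\times D_{2n}$, isomorphic to $\mathrm{Hom}_{\mathbb{C}}(V_\pi,V_\pi)$ for a unique irreducible representation $(\pi,V_\pi)$ of $D_{2n}$. "The complete set of orthogonal idempotents" for $MM(D_{2n})$ is the set of identity elements $U_\pi$ of these simple two-sided ideals, one for each ideal: so $U_\pi^2=U_\pi$, $U_\pi U_{\pi'}=0$ for $\pi\ne\pi'$, $\sum_\pi U_\pi=I$, and the ideal of type $\pi$ is $MM(D_{2n})U_\pi$. *)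

theory Defs
  imports
    Complex_Main
    "HOL-Algebra.Sym_Groups"
    "HOL-Algebra.Ideal"
    "Jordan_Normal_Form.Matrix"
    "Jordan_Normal_Form.Determinant"
    "Jordan_Normal_Form.VS_Connect"
begin

section \<open>The dihedral group inside the symmetric group\<close>

text \<open>Permutations act on \<open>{1..n}\<close> and fix everything else; the product is composition of functions.\<close>

definition rot_perm :: "nat \<Rightarrow> nat \<Rightarrow> nat" where
  "rot_perm n i = (if i \<in> {1..n} then (if i = n then 1 else i + 1) else i)"

definition refl_perm :: "nat \<Rightarrow> nat \<Rightarrow> nat" where
  "refl_perm n i = (if i \<in> {1..n} then n + 1 - i else i)"

definition dihedral :: "nat \<Rightarrow> (nat \<Rightarrow> nat) monoid" where
  "dihedral n = (sym_group n)\<lparr>carrier := generate (sym_group n) {rot_perm n, refl_perm n}\<rparr>"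

text \<open>Functions on the dihedral group are given below by their values on the elements
  \<open>R^k\<close> and \<open>C R^k\<close>. For \<open>n \<ge> 3\<close> these are \<open>2n\<close> distinct elements (\<open>0 \<le> k < n\<close>), and
  \<open>dih_exp\<close> returns that \<open>k\<close>.\<close>

definition is_rotation :: "nat \<Rightarrow> (nat \<Rightarrow> nat) \<Rightarrow> bool" where
  "is_rotation n \<sigma> \<longleftrightarrow> (\<exists>k. \<sigma> = rot_perm n ^^ k)"

definition dih_exp :: "nat \<Rightarrow> (nat \<Rightarrow> nat) \<Rightarrow> nat" where
  "dih_exp n \<sigma> = (LEAST k. \<sigma> = rot_perm n ^^ k \<or> \<sigma> = refl_perm n \<circ> (rot_perm n ^^ k))"


section \<open>Permutation matrices and the algebra they generate\<close>

text \<open>Rows and columns of matrices are numbered from 0 in the library;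
  \<open>mat_from1 n f\<close> is the matrix whose \<open>(a, b)\<close> entry is \<open>f a b\<close> for \<open>1 \<le> a, b \<le> n\<close>.\<close>

definition mat_from1 :: "nat \<Rightarrow> (nat \<Rightarrow> nat \<Rightarrow> complex) \<Rightarrow> complex mat" where
  "mat_from1 n f = mat n n (\<lambda>(i, j). f (i + 1) (j + 1))"

definition perm_mat :: "nat \<Rightarrow> (nat \<Rightarrow> nat) \<Rightarrow> complex mat" where
  "perm_mat n \<sigma> = mat_from1 n (\<lambda>j i. if \<sigma> i = j then 1 else 0)"

abbreviation cmat_ring :: "nat \<Rightarrow> complex mat ring" where
  "cmat_ring n \<equiv> ring_mat TYPE(complex) n ()"

inductive_set generated_algebra :: "nat \<Rightarrow> complex mat set \<Rightarrow> complex mat set"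
  for n :: nat and S :: "complex mat set" where
  zero: "0\<^sub>m n n \<in> generated_algebra n S"
| gen: "A \<in> S \<Longrightarrow> A \<in> generated_algebra n S"
| add: "A \<in> generated_algebra n S \<Longrightarrow> B \<in> generated_algebra n S \<Longrightarrow> A + B \<in> generated_algebra n S"
| smult: "A \<in> generated_algebra n S \<Longrightarrow> c \<cdot>\<^sub>m A \<in> generated_algebra n S"
| mult: "A \<in> generated_algebra n S \<Longrightarrow> B \<in> generated_algebra n S \<Longrightarrow> A * B \<in> generated_algebra n S"

definition MM :: "nat \<Rightarrow> complex mat ring" where
  "MM n = (cmat_ring n)\<lparr>carrier := generated_algebra n (perm_mat n ` carrier (dihedral n))\<rparr>"


section \<open>Simple two-sided ideals and the complete set of orthogonal idempotents\<close>

definition simple_ideal :: "('a, 'b) ring_scheme \<Rightarrow> 'a set \<Rightarrow> bool" where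
  "simple_ideal A I \<longleftrightarrow> ideal I A \<and> I \<noteq> {\<zero>\<^bsub>A\<^esub>} \<and>
     (\<forall>K. ideal K A \<longrightarrow> K \<subseteq> I \<longrightarrow> K = {\<zero>\<^bsub>A\<^esub>} \<or> K = I)"

definition ideal_identity :: "('a, 'b) ring_scheme \<Rightarrow> 'a set \<Rightarrow> 'a \<Rightarrow> bool" where
  "ideal_identity A I U \<longleftrightarrow> U \<in> I \<and> (\<forall>x\<in>I. U \<otimes>\<^bsub>A\<^esub> x = x \<and> x \<otimes>\<^bsub>A\<^esub> U = x)"

text \<open>The first two clauses say that \<open>E\<close> is exactly the set of identity elements of the simple
  two-sided ideals and that no simple ideal lacks an identity. The remaining clauses
  say that \<open>A\<close> is the direct sum of these ideals.\<close>

definition complete_orthogonal_idempotents :: "('a, 'b) ring_scheme \<Rightarrow> 'a set \<Rightarrow> bool" where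
  "complete_orthogonal_idempotents A E \<longleftrightarrow>
     E = {U. \<exists>I. simple_ideal A I \<and> ideal_identity A I U} \<and>
     (\<forall>I. simple_ideal A I \<longrightarrow> (\<exists>U. ideal_identity A I U)) \<and>
     finite E \<and>
     (\<forall>U\<in>E. U \<otimes>\<^bsub>A\<^esub> U = U) \<and>
     (\<forall>U\<in>E. \<forall>V\<in>E. U \<noteq> V \<longrightarrow> U \<otimes>\<^bsub>A\<^esub> V = \<zero>\<^bsub>A\<^esub>) \<and>
     (\<Oplus>\<^bsub>A\<^esub>U\<in>E. U) = \<one>\<^bsub>A\<^esub>"


section \<open>Complex representations in matrix form\<close>

definition representation :: "('g, 'b) monoid_scheme \<Rightarrow> nat \<Rightarrow> ('g \<Rightarrow> complex mat) \<Rightarrow> bool" where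
  "representation G d \<rho> \<longleftrightarrow> \<rho> \<in> hom G (units_of (cmat_ring d))"

definition irreducible_representation ::
    "('g, 'b) monoid_scheme \<Rightarrow> nat \<Rightarrow> ('g \<Rightarrow> complex mat) \<Rightarrow> bool" where
  "irreducible_representation G d \<rho> \<longleftrightarrow> representation G d \<rho> \<and> d > 0 \<and>
     (\<forall>W. VectorSpace.subspace class_ring W (module_vec TYPE(complex) d) \<longrightarrow>
          (\<forall>g\<in>carrier G. \<forall>w\<in>W. \<rho> g *\<^sub>v w \<in> W) \<longrightarrow>
          W = {0\<^sub>v d} \<or> W = carrier_vec d)"

text \<open>\<open>corresponds_to n U d \<rho>\<close>: \<open>U\<close> is the identity of a simple two-sided ideal \<open>I\<close> of \<open>MM n\<close>,
  and \<open>I\<close> is isomorphic to \<open>Hom(V, V)\<close>, \<open>V = \<complex>^d\<close> with action \<open>\<rho>\<close>, as a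
  representation of the product of two copies of the dihedral group.\<close>

definition corresponds_to ::
    "nat \<Rightarrow> complex mat \<Rightarrow> nat \<Rightarrow> ((nat \<Rightarrow> nat) \<Rightarrow> complex mat) \<Rightarrow> bool" where
  "corresponds_to n U d \<rho> \<longleftrightarrow> irreducible_representation (dihedral n) d \<rho> \<and>
     (\<exists>I. simple_ideal (MM n) I \<and> ideal_identity (MM n) I U \<and>
       (\<exists>f. bij_betw f I (carrier_mat d d) \<and>
            (\<forall>M\<in>I. \<forall>N\<in>I. f (M + N) = f M + f N) \<and>
            (\<forall>c. \<forall>M\<in>I. f (c \<cdot>\<^sub>m M) = c \<cdot>\<^sub>m f M) \<and>
            (\<forall>g\<in>carrier (dihedral n). \<forall>h\<in>carrier (dihedral n). \<forall>M\<in>I.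
               f (perm_mat n g * M * inv\<^bsub>cmat_ring n\<^esub> (perm_mat n h)) =
               \<rho> g * f M * inv\<^bsub>cmat_ring d\<^esub> (\<rho> h))))"

text \<open>One-dimensional characters as \<open>1 \<times> 1\<close> matrix representations.\<close>

definition char_rep :: "('g \<Rightarrow> complex) \<Rightarrow> 'g \<Rightarrow> complex mat" where
  "char_rep \<chi> g = mat 1 1 (\<lambda>_. \<chi> g)"

definition chi_triv :: "(nat \<Rightarrow> nat) \<Rightarrow> complex" where
  "chi_triv \<sigma> = 1"

definition chi_det :: "nat \<Rightarrow> (nat \<Rightarrow> nat) \<Rightarrow> complex" where
  "chi_det n \<sigma> = (if is_rotation n \<sigma> then 1 else - 1)"

definition chi_sgn :: "nat \<Rightarrow> (nat \<Rightarrow> nat) \<Rightarrow> complex" where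
  "chi_sgn n \<sigma> = det (perm_mat n \<sigma>)"

text \<open>The character \<open>\<chi>'\<close> of the dihedral group with \<open>n = 2 m\<close>.\<close>

definition chi_prime :: "nat \<Rightarrow> (nat \<Rightarrow> nat) \<Rightarrow> complex" where
  "chi_prime m \<sigma> = (if odd m then chi_sgn (2 * m) \<sigma> else chi_det (2 * m) \<sigma> * chi_sgn (2 * m) \<sigma>)"

definition plane_rotation :: "nat \<Rightarrow> complex mat" where
  "plane_rotation n = mat_of_rows_list 2
     [[of_real (cos (2 * pi / real n)), - of_real (sin (2 * pi / real n))],
      [of_real (sin (2 * pi / real n)), of_real (cos (2 * pi / real n))]]"

definition plane_reflection :: "complex mat" where
  "plane_reflection = mat_of_rows_list 2 [[1, 0], [0, - 1]]"

definition pi2 :: "nat \<Rightarrow> (nat \<Rightarrow> nat) \<Rightarrow> complex mat" where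
  "pi2 n \<sigma> = (let k = dih_exp n \<sigma> in
     if is_rotation n \<sigma> then plane_rotation n ^\<^sub>m k
     else plane_reflection * plane_rotation n ^\<^sub>m k)"

definition dih_phi :: "nat \<Rightarrow> nat \<Rightarrow> (nat \<Rightarrow> nat) \<Rightarrow> nat \<Rightarrow> nat" where
  "dih_phi n j \<sigma> = (let k = dih_exp n \<sigma> in
     if is_rotation n \<sigma> then rot_perm n ^^ (j * k)
     else refl_perm n \<circ> (rot_perm n ^^ (j * k)))"

definition pi2_pow :: "nat \<Rightarrow> nat \<Rightarrow> (nat \<Rightarrow> nat) \<Rightarrow> complex mat" where
  "pi2_pow n j = pi2 n \<circ> dih_phi n j"


section \<open>The explicit matrices\<close>

definition all_ones :: "nat \<Rightarrow> complex mat" where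
  "all_ones n = mat_from1 n (\<lambda>a b. 1)"

definition U_triv :: "nat \<Rightarrow> complex mat" where
  "U_triv n = (1 / of_nat n) \<cdot>\<^sub>m all_ones n"

definition U_chi' :: "nat \<Rightarrow> complex mat" where
  "U_chi' n = mat_from1 n (\<lambda>a b. 1 / of_nat n * (- 1) ^ (a + b))"

definition U_pi2 :: "nat \<Rightarrow> nat \<Rightarrow> complex mat" where
  "U_pi2 n j = (2 / of_nat n) \<cdot>\<^sub>m
     (\<Oplus>\<^bsub>cmat_ring n\<^esub>k\<in>{0..<n}.
        of_real (cos (2 * real k * real j * pi / real n)) \<cdot>\<^sub>m perm_mat n (rot_perm n ^^ k))"

end

theory Submission
  imports Defs "HOL-Algebra.Subrings"
begin

text \<open>The permutation representation of the dihedral group on \<open>\<complex>^n\<close>, \<open>n = 2 m\<close>, is block-diagonalized by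
  the discrete Fourier transform. In real form: sample \<open>cos (j t)\<close> and \<open>sin (j t)\<close> at the points
  \<open>t = 2 \<pi> (i + 1/2) / n\<close>. For \<open>0 < j < m\<close> the two samples span a plane on which the rotation of the
  indices acts as rotation by \<open>2 \<pi> j / n\<close> and the reflection as \<open>diag(1, -1)\<close>, that is, as \<open>\<pi>\<^sub>2^j\<close>;
  for \<open>j = 0\<close> the cosine is constant and gives the trivial character; for \<open>j = m\<close> the sine is
  \<open>(-1) ^ i\<close> and changes sign under both generators, which gives \<open>\<chi>'\<close>. These \<open>m + 1\<close> subspaces are mutually
  orthogonal (\<open>wave_gram\<close>) and span everything (\<open>wave_complete\<close>), and the orthogonal projections onto
  them are the circulant matrices with entries \<open>(d / n) cos (2 \<pi> j (a - b) / n)\<close>, \<open>d\<close> being the dimension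
  of the subspace (\<open>wave_mat_times_wave_dual\<close>). These are the matrices \<open>U\<close> of the theorem.

  It remains to see that the algebra generated by the permutation matrices is the full algebra of
  block-diagonal matrices for this splitting. Each projection is a combination of rotations, and
  on each plane the dihedral group spans all \<open>2 \<times> 2\<close> matrices, since \<open>sin (2 \<pi> j / n) \<noteq> 0\<close>
  (\<open>wave_block_in_algebra\<close>).

  The passage from such a splitting to simple ideals, their identities and the isomorphisms with
  \<open>Hom(V, V)\<close> concerns any group; it is the content of the locale \<open>isotypic_decomposition\<close>. There
  the intertwiner \<open>B j\<close> embeds \<open>\<complex>^d\<close> as the \<open>j\<close>-th subspace, \<open>B' j\<close> is its dual, and the simple ideals
  are the sets of all \<open>B j * X * B' j\<close> with \<open>X\<close> a \<open>d \<times> d\<close> matrix.\<close>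

section \<open>Matrix algebras with a complete system of blocks\<close>

text \<open>Matrix associativity and distributivity conditioned on equations between dimensions instead
  of carrier membership: the simplifier can discharge such conditions, whereas the carrier form
  leaves it with dimensions that the left-hand side does not determine.\<close>

lemma mat_assoc:
  fixes A B C :: "complex mat"
  shows "dim_col A = dim_row B \<Longrightarrow> dim_col B = dim_row C \<Longrightarrow> A * B * C = A * (B * C)"
  by (rule assoc_mult_mat) auto

lemma mat_distribs:
  fixes A B C :: "complex mat"
  shows "dim_col A = dim_row B \<Longrightarrow> dim_row B = dim_row C \<Longrightarrow> dim_col B = dim_col C \<Longrightarrow> A * (B + C) = A * B + A * C"
    and "dim_col A = dim_row C \<Longrightarrow> dim_row A = dim_row B \<Longrightarrow> dim_col A = dim_col B \<Longrightarrow> (A + B) * C = A * C + B * C"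
    and "dim_col A = dim_row B \<Longrightarrow> A * (a \<cdot>\<^sub>m B) = a \<cdot>\<^sub>m (A * B)"
    and "dim_col A = dim_row B \<Longrightarrow> (a \<cdot>\<^sub>m A) * B = a \<cdot>\<^sub>m (A * B)"
    apply (rule mult_add_distrib_mat; auto)
   apply (rule add_mult_distrib_mat; auto)
  apply (rule mult_smult_distrib; auto)
  apply (rule mult_smult_assoc_mat; auto)
  done

lemma generated_algebra_carrier:
  assumes "S \<subseteq> carrier_mat n n"
  shows "generated_algebra n S \<subseteq> carrier_mat n n"
proof
  fix M assume "M \<in> generated_algebra n S"
  then show "M \<in> carrier_mat n n"
    by induction (use assms in auto)
qed

text \<open>Additive inverses come from the closure under the scalar \<open>-1\<close>.\<close>

lemma ring_generated_algebra:
  assumes "S \<subseteq> carrier_mat n n" and "1\<^sub>m n \<in> generated_algebra n S"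
  shows "ring ((cmat_ring n)\<lparr>carrier := generated_algebra n S\<rparr>)"
proof -
  interpret M: ring "cmat_ring n" by (rule ring_mat)
  note carr = subsetD[OF generated_algebra_carrier[OF assms(1)]]
  have "subring (generated_algebra n S) (cmat_ring n)"
  proof (rule M.subringI)
    fix X assume X: "X \<in> generated_algebra n S"
    have "(-1) \<cdot>\<^sub>m X + X = 0\<^sub>m n n"
      using carr[OF X] by (intro eq_matI) auto
    then have "\<ominus>\<^bsub>cmat_ring n\<^esub> X = (-1) \<cdot>\<^sub>m X"
      using carr[OF X] by (intro M.minus_equality) (auto simp: ring_mat_simps)
    then show "\<ominus>\<^bsub>cmat_ring n\<^esub> X \<in> generated_algebra n S"
      using generated_algebra.smult[OF X] by simp
  qed (use assms carr in \<open>auto simp: ring_mat_simps intro: generated_algebra.intros\<close>)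
  then show ?thesis by (rule M.subring_is_ring)
qed

text \<open>Stated for an arbitrary carrier, so that it serves both the full matrix ring and a subalgebra.\<close>

lemma index_finsum_mat:
  assumes "abelian_monoid ((cmat_ring n)\<lparr>carrier := H\<rparr>)" and "H \<subseteq> carrier_mat n n"
    and "finite K" and "f ` K \<subseteq> H"
  shows "finsum ((cmat_ring n)\<lparr>carrier := H\<rparr>) f K = mat n n (\<lambda>(a, b). \<Sum>k\<in>K. f k $$ (a, b))"
  using assms(3,4)
proof (induction K rule: finite_induct)
  case empty
  interpret R: abelian_monoid "(cmat_ring n)\<lparr>carrier := H\<rparr>" by fact
  have "finsum ((cmat_ring n)\<lparr>carrier := H\<rparr>) f {} = 0\<^sub>m n n"
    using R.finsum_empty[of f] by (simp add: ring_mat_simps)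
  then show ?case by (auto intro!: eq_matI)
next
  case (insert x F)
  interpret R: abelian_monoid "(cmat_ring n)\<lparr>carrier := H\<rparr>" by fact
  have fx: "f x \<in> carrier_mat n n" using insert.prems assms(2) by auto
  have "f \<in> F \<rightarrow> H" "f x \<in> H" using insert.prems by auto
  then have "finsum ((cmat_ring n)\<lparr>carrier := H\<rparr>) f (insert x F) =
      f x + finsum ((cmat_ring n)\<lparr>carrier := H\<rparr>) f F"
    using R.finsum_insert[OF insert.hyps, of f] by (simp add: ring_mat_simps)
  also have "finsum ((cmat_ring n)\<lparr>carrier := H\<rparr>) f F = mat n n (\<lambda>(a, b). \<Sum>k\<in>F. f k $$ (a, b))"
    using insert by auto
  also have "f x + \<dots> = mat n n (\<lambda>(a, b). \<Sum>k\<in>insert x F. f k $$ (a, b))"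
    by (intro eq_matI) (use fx insert.hyps in auto)
  finally show ?case .
qed

lemma generated_algebra_sum:
  assumes S: "S \<subseteq> carrier_mat n n" and "finite K" and "f ` K \<subseteq> generated_algebra n S"
  shows "mat n n (\<lambda>(a, b). \<Sum>k\<in>K. f k $$ (a, b)) \<in> generated_algebra n S"
  using assms(2,3)
proof (induction K rule: finite_induct)
  case empty
  have "mat n n (\<lambda>(a, b). \<Sum>k\<in>{}. f k $$ (a, b)) = 0\<^sub>m n n" by (intro eq_matI) auto
  then show ?case using generated_algebra.zero by metis
next
  case (insert x F)
  have "f x \<in> carrier_mat n n" using insert.prems generated_algebra_carrier[OF S] by auto
  then have "mat n n (\<lambda>(a, b). \<Sum>k\<in>insert x F. f k $$ (a, b)) =
      f x + mat n n (\<lambda>(a, b). \<Sum>k\<in>F. f k $$ (a, b))"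
    by (intro eq_matI) (use insert.hyps in auto)
  also have "\<dots> \<in> generated_algebra n S"
  proof (rule generated_algebra.add)
    show "f x \<in> generated_algebra n S" using insert.prems by blast
    show "mat n n (\<lambda>(a, b). \<Sum>k\<in>F. f k $$ (a, b)) \<in> generated_algebra n S"
      using insert.IH insert.prems by blast
  qed
  finally show ?case .
qed

text \<open>Simplicity of the full matrix algebra. If \<open>X\<close> has a nonzero entry at \<open>(p, q)\<close>, then
  multiplying by a matrix supported on column \<open>p\<close> from the left and by the matrix unit \<open>(q, b)\<close>
  from the right produces an arbitrary column \<open>b\<close>; a sum over \<open>b\<close> assembles \<open>Y\<close>.\<close>

lemma mat_algebra_simple:
  fixes T :: "complex mat set"
  assumes "X \<in> T" and "X \<in> carrier_mat d d" and "X \<noteq> 0\<^sub>m d d"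
    and zero: "0\<^sub>m d d \<in> T"
    and add: "\<And>Y Z. Y \<in> T \<Longrightarrow> Z \<in> T \<Longrightarrow> Y + Z \<in> T"
    and mult: "\<And>L Y R. L \<in> carrier_mat d d \<Longrightarrow> Y \<in> T \<Longrightarrow> R \<in> carrier_mat d d \<Longrightarrow> L * Y * R \<in> T"
    and Y: "Y \<in> carrier_mat d d"
  shows "Y \<in> T"
proof -
  obtain p q where pq: "p < d" "q < d" "X $$ (p, q) \<noteq> 0"
    using assms(2,3) by (metis carrier_matD eq_matI index_zero_mat)
  define L where "L b = mat d d (\<lambda>(i, j). if j = p then Y $$ (i, b) / X $$ (p, q) else 0)" for b
  define R :: "nat \<Rightarrow> complex mat" where "R b = mat d d (\<lambda>(i, j). if i = q \<and> j = b then 1 else 0)" for b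
  have LR: "(L b * X * R b) $$ (i, j) = (if j = b then Y $$ (i, b) else 0)"
    if "i < d" "j < d" "b < d" for b i j
  proof -
    have 1: "(L b * X) $$ (i, k) = Y $$ (i, b) / X $$ (p, q) * X $$ (p, k)" if "k < d" for k
    proof -
      have "(L b * X) $$ (i, k) = (\<Sum>l<d. L b $$ (i, l) * X $$ (l, k))"
        using \<open>i < d\<close> that assms(2) by (auto simp: scalar_prod_def L_def atLeast0LessThan)
      also have "\<dots> = (\<Sum>l<d. if l = p then Y $$ (i, b) / X $$ (p, q) * X $$ (l, k) else 0)"
        using \<open>i < d\<close> by (intro sum.cong) (auto simp: L_def)
      finally show ?thesis using pq by simp
    qed
    have "(L b * X * R b) $$ (i, j) = (\<Sum>k<d. (L b * X) $$ (i, k) * R b $$ (k, j))"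
      using that assms(2) by (auto simp: scalar_prod_def R_def L_def atLeast0LessThan)
    also have "\<dots> = (\<Sum>k<d. if k = q then (if j = b then Y $$ (i, b) / X $$ (p, q) * X $$ (p, k) else 0) else 0)"
      using that by (intro sum.cong) (auto simp: 1 R_def)
    finally show ?thesis using pq by simp
  qed
  have "mat d d (\<lambda>(i, j). if j < b then Y $$ (i, j) else 0) \<in> T" if "b \<le> d" for b
    using that
  proof (induction b)
    case 0
    have "mat d d (\<lambda>(i, j). if j < (0::nat) then Y $$ (i, j) else 0) = 0\<^sub>m d d"
      by (intro eq_matI) auto
    then show ?case using zero by metis
  next
    case (Suc b)
    have dims: "dim_row (L b) = d" "dim_col (R b) = d" by (simp_all add: L_def R_def)
    have "mat d d (\<lambda>(i, j). if j < Suc b then Y $$ (i, j) else 0) =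
        mat d d (\<lambda>(i, j). if j < b then Y $$ (i, j) else 0) + L b * X * R b"
      using Suc.prems by (intro eq_matI) (auto simp: dims LR simp del: index_mult_mat(1))
    also have "\<dots> \<in> T"
      using Suc assms(1) by (intro add mult) (auto simp: L_def R_def)
    finally show ?case .
  qed
  from this[of d] have "mat d d (\<lambda>(i, j). if j < d then Y $$ (i, j) else 0) \<in> T" by simp
  also have "mat d d (\<lambda>(i, j). if j < d then Y $$ (i, j) else 0) = Y"
    using Y by (intro eq_matI) auto
  finally show ?thesis .
qed

text \<open>Irreducibility of \<open>\<complex>^d\<close> under all matrices.\<close>

lemma vec_in_mat_orbit:
  fixes v w :: "complex vec"
  assumes "w \<in> carrier_vec d" and "w \<noteq> 0\<^sub>v d" and "v \<in> carrier_vec d"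
  obtains X where "X \<in> carrier_mat d d" and "X *\<^sub>v w = v"
proof -
  obtain p where p: "p < d" "w $ p \<noteq> 0"
    using assms(1,2) by (metis carrier_vecD eq_vecI index_zero_vec)
  define X where "X = mat d d (\<lambda>(i, j). if j = p then v $ i / w $ p else 0)"
  have "X *\<^sub>v w = v"
  proof (rule eq_vecI)
    fix i assume i: "i < dim_vec v"
    have "(X *\<^sub>v w) $ i = (\<Sum>j<d. if j = p then v $ i / w $ p * w $ j else 0)"
    proof -
      have "(X *\<^sub>v w) $ i = (\<Sum>j<d. X $$ (i, j) * w $ j)"
        using i assms by (auto simp: X_def scalar_prod_def atLeast0LessThan)
      also have "\<dots> = (\<Sum>j<d. if j = p then v $ i / w $ p * w $ j else 0)"
        using i assms by (intro sum.cong) (auto simp: X_def)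
      finally show ?thesis .
    qed
    then show "(X *\<^sub>v w) $ i = v $ i" using p by simp
  qed (use assms in \<open>auto simp: X_def\<close>)
  moreover have "X \<in> carrier_mat d d" by (simp add: X_def)
  ultimately show thesis by (rule that[rotated])
qed

text \<open>A splitting of a matrix representation \<open>P\<close> without multiplicities: the columns of \<open>B j\<close>
  form a basis of an invariant subspace on which \<open>P\<close> acts as \<open>\<rho> j\<close>, and \<open>B' j\<close> reads off the
  coordinates in it. The condition \<open>full\<close> says that every endomorphism of one subspace, extended by zero
  to the others, belongs to the algebra generated by the group; it implies both that
  the \<open>\<rho> j\<close> are irreducible and that they are pairwise inequivalent.\<close>

locale isotypic_decomposition = group G for G (structure) +
  fixes n :: nat and P :: "'a \<Rightarrow> complex mat" and J :: "'j set" and d :: "'j \<Rightarrow> nat"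
    and B B' :: "'j \<Rightarrow> complex mat" and \<rho> :: "'j \<Rightarrow> 'a \<Rightarrow> complex mat"
  assumes rep: "representation G n P"
    and finite_J: "finite J"
    and d_pos: "j \<in> J \<Longrightarrow> d j > 0"
    and B_carrier: "j \<in> J \<Longrightarrow> B j \<in> carrier_mat n (d j)"
    and B'_carrier: "j \<in> J \<Longrightarrow> B' j \<in> carrier_mat (d j) n"
    and \<rho>_carrier: "j \<in> J \<Longrightarrow> g \<in> carrier G \<Longrightarrow> \<rho> j g \<in> carrier_mat (d j) (d j)"
    and left_inverse: "j \<in> J \<Longrightarrow> B' j * B j = 1\<^sub>m (d j)"
    and orthogonal: "j \<in> J \<Longrightarrow> k \<in> J \<Longrightarrow> j \<noteq> k \<Longrightarrow> B' j * B k = 0\<^sub>m (d j) (d k)"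
    and complete: "a < n \<Longrightarrow> b < n \<Longrightarrow> (\<Sum>j\<in>J. (B j * B' j) $$ (a, b)) = (if a = b then 1 else 0)"
    and intertwines: "j \<in> J \<Longrightarrow> g \<in> carrier G \<Longrightarrow> P g * B j = B j * \<rho> j g"
    and full: "j \<in> J \<Longrightarrow> X \<in> carrier_mat (d j) (d j) \<Longrightarrow>
      B j * X * B' j \<in> generated_algebra n (P ` carrier G)"
begin

lemma dims [simp]:
  assumes "j \<in> J"
  shows "dim_row (B j) = n" "dim_col (B j) = d j" "dim_row (B' j) = d j" "dim_col (B' j) = n"
  using B_carrier[OF assms] B'_carrier[OF assms] by auto

lemma cancel_left_inverse [simp]:
  assumes "j \<in> J" "dim_row Z = d j"
  shows "B' j * (B j * Z) = Z"
proof -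
  have "B' j * (B j * Z) = B' j * B j * Z" using assms by (simp add: mat_assoc)
  then show ?thesis using assms by (simp add: left_inverse)
qed

lemma cancel_orthogonal [simp]:
  assumes "j \<in> J" "k \<in> J" "j \<noteq> k" "dim_row Z = d k"
  shows "B' j * (B k * Z) = 0\<^sub>m (d j) (dim_col Z)"
proof -
  have "B' j * (B k * Z) = B' j * B k * Z" using assms by (simp add: mat_assoc)
  then show ?thesis using assms by (simp add: orthogonal)
qed

abbreviation alg :: "complex mat ring" where
  "alg \<equiv> (cmat_ring n)\<lparr>carrier := generated_algebra n (P ` carrier G)\<rparr>"

abbreviation U :: "'j \<Rightarrow> complex mat" where
  "U j \<equiv> B j * B' j"

definition block :: "'j \<Rightarrow> complex mat set" where
  "block j = (\<lambda>X. B j * X * B' j) ` carrier_mat (d j) (d j)"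

lemma P_carrier: "g \<in> carrier G \<Longrightarrow> P g \<in> carrier_mat n n"
  using rep by (auto simp: representation_def hom_def units_of_def Units_def ring_mat_simps)

lemma P_mult: "g \<in> carrier G \<Longrightarrow> h \<in> carrier G \<Longrightarrow> P (g \<otimes> h) = P g * P h"
  using rep by (auto simp: representation_def hom_def units_of_def ring_mat_simps)

lemma P_one: "P \<one> = 1\<^sub>m n"
proof -
  interpret M: ring "cmat_ring n" by (rule ring_mat)
  interpret U: group "units_of (cmat_ring n)" by (rule M.units_group)
  show ?thesis
    using hom_one[OF rep[unfolded representation_def] is_group U.is_group]
    by (simp add: units_of_def ring_mat_simps)
qed

lemma alg_carrier: "generated_algebra n (P ` carrier G) \<subseteq> carrier_mat n n"
  using P_carrier by (intro generated_algebra_carrier) auto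

lemma one_in_alg: "1\<^sub>m n \<in> generated_algebra n (P ` carrier G)"
  using P_one by (metis generated_algebra.gen image_eqI one_closed)

lemma ring_alg: "ring alg"
  using P_carrier one_in_alg by (intro ring_generated_algebra) auto

lemma U_in_block: "j \<in> J \<Longrightarrow> U j \<in> block j"
  unfolding block_def
  by (rule image_eqI[of _ _ "1\<^sub>m (d j)"]) (simp_all add: right_mult_one_mat[OF B_carrier])

lemma block_in_alg: "j \<in> J \<Longrightarrow> block j \<subseteq> generated_algebra n (P ` carrier G)"
  using full by (auto simp: block_def)

lemma alg_dims:
  assumes "M \<in> generated_algebra n (P ` carrier G)"
  shows "dim_row M = n" "dim_col M = n"
  using assms alg_carrier by auto

text \<open>The image of \<open>B j\<close> is invariant under the generators, hence under the algebra.\<close>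

lemma compress_right:
  assumes "M \<in> generated_algebra n (P ` carrier G)" and j: "j \<in> J"
  shows "M * B j = B j * (B' j * M * B j)"
proof -
  have "\<exists>Y\<in>carrier_mat (d j) (d j). M * B j = B j * Y"
    using assms(1)
  proof induction
    case zero
    then show ?case using j by (intro bexI[of _ "0\<^sub>m (d j) (d j)"]) auto
  next
    case (gen A)
    then show ?case using intertwines[OF j] \<rho>_carrier[OF j] by blast
  next
    case (add A C)
    then obtain Y Z where YZ: "Y \<in> carrier_mat (d j) (d j)" "A * B j = B j * Y"
      "Z \<in> carrier_mat (d j) (d j)" "C * B j = B j * Z" by blast
    have "(A + C) * B j = B j * (Y + Z)"
      using YZ(2,4) j by (simp add: mat_distribs alg_dims[OF add.hyps(1)] alg_dims[OF add.hyps(2)]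
          carrier_matD[OF YZ(1)] carrier_matD[OF YZ(3)])
    then show ?case using YZ by (intro bexI[of _ "Y + Z"]) auto
  next
    case (smult A c)
    then obtain Y where Y: "Y \<in> carrier_mat (d j) (d j)" "A * B j = B j * Y" by blast
    have "(c \<cdot>\<^sub>m A) * B j = B j * (c \<cdot>\<^sub>m Y)"
      using Y(2) j by (simp add: mat_distribs alg_dims[OF smult.hyps] carrier_matD[OF Y(1)])
    then show ?case using Y by (intro bexI[of _ "c \<cdot>\<^sub>m Y"]) auto
  next
    case (mult A C)
    then obtain Y Z where YZ: "Y \<in> carrier_mat (d j) (d j)" "A * B j = B j * Y"
      "Z \<in> carrier_mat (d j) (d j)" "C * B j = B j * Z" by blast
    note dimAC = alg_dims[OF mult.hyps(1)] alg_dims[OF mult.hyps(2)]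
      carrier_matD[OF YZ(1)] carrier_matD[OF YZ(3)]
    have "A * C * B j = A * B j * Z"
      using YZ(4) j by (simp add: mat_assoc dimAC)
    also have "\<dots> = B j * (Y * Z)"
      using YZ(2) j by (simp add: mat_assoc dimAC)
    finally show ?case using YZ by (intro bexI[of _ "Y * Z"]) auto
  qed
  then obtain Y where Y: "Y \<in> carrier_mat (d j) (d j)" "M * B j = B j * Y" by blast
  have "B' j * M * B j = Y"
    using Y(2) j by (simp add: mat_assoc alg_dims[OF assms(1)] carrier_matD[OF Y(1)])
  then show ?thesis using Y by simp
qed

text \<open>By completeness, \<open>K\<close> is the sum of the matrices \<open>K * B j * B' j\<close>.\<close>

lemma eq_if_eq_on_blocks:
  assumes M: "M \<in> carrier_mat r n" and N: "N \<in> carrier_mat r n"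
    and eq: "\<And>j. j \<in> J \<Longrightarrow> M * B j = N * B j"
  shows "M = N"
proof -
  have expand: "K $$ (a, b) = (\<Sum>j\<in>J. (K * B j * B' j) $$ (a, b))"
    if K: "K \<in> carrier_mat r n" and a: "a < r" and b: "b < n" for K a b
  proof -
    have "(K * B j * B' j) $$ (a, b) = (\<Sum>c<n. K $$ (a, c) * U j $$ (c, b))" if "j \<in> J" for j
    proof -
      note carr = K B_carrier[OF that] B'_carrier[OF that]
      have "K * B j * B' j = K * U j" using carr by (rule assoc_mult_mat)
      moreover have "U j \<in> carrier_mat n n" using carr by simp
      moreover have "(K * V) $$ (a, b) = (\<Sum>c<n. K $$ (a, c) * V $$ (c, b))"
        if "V \<in> carrier_mat n n" for V
        using a b K that by (auto simp: scalar_prod_def atLeast0LessThan)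
      ultimately show ?thesis by simp
    qed
    then have "(\<Sum>j\<in>J. (K * B j * B' j) $$ (a, b)) = (\<Sum>j\<in>J. \<Sum>c<n. K $$ (a, c) * U j $$ (c, b))"
      by (intro sum.cong) auto
    also have "\<dots> = (\<Sum>c<n. K $$ (a, c) * (\<Sum>j\<in>J. U j $$ (c, b)))"
      by (subst sum.swap) (simp add: sum_distrib_left)
    also have "\<dots> = (\<Sum>c<n. if c = b then K $$ (a, c) else 0)"
      using complete b by (intro sum.cong) auto
    finally show ?thesis using b by simp
  qed
  show ?thesis
    using M N by (intro eq_matI) (auto simp: expand eq simp del: index_mult_mat(1))
qed

text \<open>The kernel of \<open>B' j\<close> is invariant as well: it is spanned by the images of the other \<open>B k\<close>.\<close>

lemma compress_left:
  assumes M: "M \<in> generated_algebra n (P ` carrier G)" and j: "j \<in> J"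
  shows "B' j * M = B' j * M * B j * B' j"
proof (rule eq_if_eq_on_blocks[of _ "d j"])
  note [simp] = alg_dims[OF M]
  show "B' j * M \<in> carrier_mat (d j) n" "B' j * M * B j * B' j \<in> carrier_mat (d j) n"
    using j by auto
  fix k assume k: "k \<in> J"
  show "B' j * M * B k = B' j * M * B j * B' j * B k"
  proof (cases "k = j")
    case True
    then show ?thesis using j by (simp add: mat_assoc left_inverse)
  next
    case False
    have "B' j * M * B k = B' j * (B k * (B' k * M * B k))"
      using j k compress_right[OF M k] by (simp add: mat_assoc)
    also have "\<dots> = 0\<^sub>m (d j) (d k)" using j k False by simp
    finally show ?thesis using j k False by (simp add: mat_assoc orthogonal)
  qed
qed

lemma compress_of_expand:
  assumes "j \<in> J" and "X \<in> carrier_mat (d j) (d j)"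
  shows "B' j * (B j * X * B' j) * B j = X"
  using assms(1) by (simp add: mat_assoc left_inverse carrier_matD[OF assms(2)])

text \<open>Multiplying an element of a block by an element of the algebra amounts to multiplying the
  two compressions; in particular the block is a two-sided ideal.\<close>

lemma alg_times_block:
  assumes M: "M \<in> generated_algebra n (P ` carrier G)" and j: "j \<in> J"
    and X: "X \<in> carrier_mat (d j) (d j)"
  shows "M * (B j * X * B' j) = B j * (B' j * M * B j * X) * B' j"
    and "(B j * X * B' j) * M = B j * (X * (B' j * M * B j)) * B' j"
proof -
  note [simp] = alg_dims[OF M] carrier_matD[OF X]
  have "M * (B j * X * B' j) = M * B j * X * B' j" using j by (simp add: mat_assoc)
  also have "\<dots> = B j * (B' j * M * B j) * X * B' j" using compress_right[OF M j] by simp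
  also have "\<dots> = B j * (B' j * M * B j * X) * B' j" using j by (simp add: mat_assoc)
  finally show "M * (B j * X * B' j) = B j * (B' j * M * B j * X) * B' j" .
  have "(B j * X * B' j) * M = B j * X * (B' j * M)" using j by (simp add: mat_assoc)
  also have "\<dots> = B j * X * (B' j * M * B j * B' j)" using compress_left[OF M j] by simp
  also have "\<dots> = B j * (X * (B' j * M * B j)) * B' j" using j by (simp add: mat_assoc)
  finally show "(B j * X * B' j) * M = B j * (X * (B' j * M * B j)) * B' j" .
qed

lemma expand_mult:
  assumes j: "j \<in> J" and X: "X \<in> carrier_mat (d j) (d j)" and Y: "Y \<in> carrier_mat (d j) (d j)"
  shows "(B j * X * B' j) * (B j * Y * B' j) = B j * (X * Y) * B' j"
  using alg_times_block(1)[OF full[OF j X] j Y] compress_of_expand[OF j X] by simp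

lemma U_neutral:
  assumes j: "j \<in> J" and "M \<in> block j"
  shows "U j * M = M" and "M * U j = M"
proof -
  obtain X where X: "X \<in> carrier_mat (d j) (d j)" and M: "M = B j * X * B' j"
    using assms(2) by (auto simp: block_def)
  have U: "U j = B j * 1\<^sub>m (d j) * B' j" using j by simp
  show "U j * M = M" "M * U j = M"
    unfolding M U using X by (simp_all add: expand_mult[OF j])
qed

lemma block_mult_distinct:
  assumes "j \<in> J" "k \<in> J" "j \<noteq> k" "M \<in> block j" "N \<in> block k"
  shows "M * N = 0\<^sub>m n n"
proof -
  obtain X Y where X: "X \<in> carrier_mat (d j) (d j)" "M = B j * X * B' j"
    and Y: "Y \<in> carrier_mat (d k) (d k)" "N = B k * Y * B' k"
    using assms(4,5) by (auto simp: block_def)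
  show ?thesis
    unfolding X(2) Y(2) using assms(1-3)
    by (simp add: mat_assoc carrier_matD[OF X(1)] carrier_matD[OF Y(1)])
qed

lemma U_nonzero: "j \<in> J \<Longrightarrow> U j \<noteq> 0\<^sub>m n n"
proof
  assume j: "j \<in> J" and "U j = 0\<^sub>m n n"
  then have "B' j * (B j * 1\<^sub>m (d j) * B' j) * B j = 0\<^sub>m (d j) (d j)"
    using j by simp
  then have "(1\<^sub>m (d j) :: complex mat) = 0\<^sub>m (d j) (d j)"
    using compress_of_expand[OF j, of "1\<^sub>m (d j)"] by simp
  then have "(1\<^sub>m (d j) :: complex mat) $$ (0, 0) = 0"
    using d_pos[OF j] by simp
  then show False using d_pos[OF j] by simp
qed

lemma ideal_block:
  assumes j: "j \<in> J"
  shows "ideal (block j) alg"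
proof -
  note c = B_carrier[OF j] B'_carrier[OF j]
  interpret A: ring alg by (rule ring_alg)
  have sub: "block j \<subseteq> carrier alg" using block_in_alg[OF j] by simp
  show ?thesis
  proof (rule idealI[OF ring_alg])
    show "subgroup (block j) (add_monoid alg)"
    proof (rule A.add.subgroupI)
      show "block j \<noteq> {}" using U_in_block[OF j] by auto
    next
      fix M assume M: "M \<in> block j"
      then obtain X where X: "X \<in> carrier_mat (d j) (d j)" "M = B j * X * B' j"
        by (auto simp: block_def)
      have "(-1) \<cdot>\<^sub>m M = B j * ((-1) \<cdot>\<^sub>m X) * B' j"
        using j by (simp add: X(2) mat_distribs carrier_matD[OF X(1)])
      then have in_block: "(-1) \<cdot>\<^sub>m M \<in> block j"
        unfolding block_def by (rule image_eqI) (use X(1) in auto)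
      have "M \<in> carrier_mat n n" using X c by auto
      then have "(-1) \<cdot>\<^sub>m M + M = 0\<^sub>m n n" by (intro eq_matI) auto
      then have "\<ominus>\<^bsub>alg\<^esub> M = (-1) \<cdot>\<^sub>m M"
        using M in_block sub by (intro A.minus_equality) (auto simp: ring_mat_simps)
      then show "\<ominus>\<^bsub>alg\<^esub> M \<in> block j" using in_block by simp
    next
      fix M N assume "M \<in> block j" "N \<in> block j"
      then obtain X Y where X: "X \<in> carrier_mat (d j) (d j)" "M = B j * X * B' j"
        and Y: "Y \<in> carrier_mat (d j) (d j)" "N = B j * Y * B' j"
        by (auto simp: block_def)
      have "M + N = B j * (X + Y) * B' j"
        using j by (simp add: X(2) Y(2) mat_distribs carrier_matD[OF X(1)] carrier_matD[OF Y(1)])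
      then have "M + N \<in> block j"
        unfolding block_def by (rule image_eqI) (use X(1) Y(1) in auto)
      then show "M \<oplus>\<^bsub>alg\<^esub> N \<in> block j" by (simp add: ring_mat_simps)
    qed (use sub in auto)
  next
    fix M N assume "M \<in> block j" and N: "N \<in> carrier alg"
    then obtain X where X: "X \<in> carrier_mat (d j) (d j)" "M = B j * X * B' j"
      by (auto simp: block_def)
    have N': "N \<in> generated_algebra n (P ` carrier G)" using N by simp
    have Y: "B' j * N * B j \<in> carrier_mat (d j) (d j)" using j by auto
    have "N * M \<in> block j" "M * N \<in> block j"
      using alg_times_block[OF N' j X(1)] Y X(1) by (auto simp: block_def X(2))
    then show "N \<otimes>\<^bsub>alg\<^esub> M \<in> block j" "M \<otimes>\<^bsub>alg\<^esub> N \<in> block j"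
      by (simp_all add: ring_mat_simps)
  qed
qed

text \<open>A nonzero \<open>M\<close> in \<open>K\<close> is nonzero on some \<open>B j\<close>, so its compression there is a nonzero matrix,
  and \<open>M * U j\<close> is an element of \<open>K\<close> in the block. The matrices whose expansion lies in \<open>K\<close>
  form a two-sided ideal of a full matrix algebra, which is simple.\<close>

lemma nonzero_ideal_contains_block:
  assumes K: "ideal K alg" and nz: "K \<noteq> {0\<^sub>m n n}"
  obtains j where "j \<in> J" and "block j \<subseteq> K"
proof -
  interpret K: ideal K alg by fact
  have zero: "0\<^sub>m n n \<in> K"
    using additive_subgroup.zero_closed[OF ideal.axioms(1)[OF K]] by (simp add: ring_mat_simps)
  then obtain M where M: "M \<in> K" "M \<noteq> 0\<^sub>m n n" using nz by auto
  have MA: "M \<in> generated_algebra n (P ` carrier G)" using K.a_subset M by auto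
  then have Mc: "M \<in> carrier_mat n n" using alg_carrier by auto
  obtain j where j: "j \<in> J" and MB: "M * B j \<noteq> 0\<^sub>m n n * B j"
    using eq_if_eq_on_blocks[OF Mc zero_carrier_mat] M(2) by blast
  note c = B_carrier[OF j] B'_carrier[OF j]
  let ?T = "{X \<in> carrier_mat (d j) (d j). B j * X * B' j \<in> K}"
  let ?X = "B' j * M * B j"
  have left: "N * L \<in> K" and right: "L * N \<in> K"
    if "N \<in> K" "L \<in> generated_algebra n (P ` carrier G)" for N L
    using K.I_l_closed[of N L] K.I_r_closed[of N L] that by (auto simp: ring_mat_simps)
  have Xc: "?X \<in> carrier_mat (d j) (d j)" using c Mc by auto
  have "M * U j = M * B j * B' j" using j Mc by (simp add: mat_assoc)
  then have "B j * ?X * B' j = M * U j" using compress_right[OF MA j] by simp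
  moreover have "M * U j \<in> K"
    using left[OF M(1)] U_in_block[OF j] block_in_alg[OF j] by auto
  ultimately have XT: "?X \<in> ?T" using Xc by simp
  have "?X \<noteq> 0\<^sub>m (d j) (d j)"
  proof
    assume "?X = 0\<^sub>m (d j) (d j)"
    then have "M * B j = 0\<^sub>m n (d j)" using compress_right[OF MA j] j by simp
    then show False using MB j by simp
  qed
  have "Y \<in> ?T" if Y: "Y \<in> carrier_mat (d j) (d j)" for Y
  proof (rule mat_algebra_simple[OF XT Xc \<open>?X \<noteq> _\<close> _ _ _ Y])
    show "0\<^sub>m (d j) (d j) \<in> ?T" using j zero by simp
  next
    fix Y Z assume "Y \<in> ?T" "Z \<in> ?T"
    moreover have "B j * (Y + Z) * B' j = B j * Y * B' j + B j * Z * B' j"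
      if "Y \<in> carrier_mat (d j) (d j)" "Z \<in> carrier_mat (d j) (d j)"
      using j by (simp add: mat_distribs carrier_matD[OF that(1)] carrier_matD[OF that(2)])
    ultimately show "Y + Z \<in> ?T"
      using additive_subgroup.a_closed[OF ideal.axioms(1)[OF K]] by (auto simp: ring_mat_simps)
  next
    fix L Y R :: "complex mat" assume L: "L \<in> carrier_mat (d j) (d j)" and Y: "Y \<in> ?T" and R: "R \<in> carrier_mat (d j) (d j)"
    then have "(B j * L * B' j) * (B j * Y * B' j) * (B j * R * B' j) \<in> K"
      using left[OF right[OF _ full[OF j L]] full[OF j R]] by blast
    then show "L * Y * R \<in> ?T"
      using L R Y by (auto simp: expand_mult[OF j])
  qed
  then have "block j \<subseteq> K" by (auto simp: block_def)
  with j show thesis by (rule that)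
qed

lemma block_eq_if_subset:
  assumes "j \<in> J" "k \<in> J" "block k \<subseteq> block j"
  shows "k = j"
proof (rule ccontr)
  assume "k \<noteq> j"
  then have "U k * U k = 0\<^sub>m n n"
    using assms U_in_block by (intro block_mult_distinct[of k j]) auto
  then show False
    using U_neutral[OF assms(2) U_in_block[OF assms(2)]] U_nonzero[OF assms(2)] by simp
qed

text \<open>Every nonzero ideal contains a block, and no block contains another one.\<close>

lemma simple_ideal_iff: "simple_ideal alg I \<longleftrightarrow> (\<exists>j\<in>J. I = block j)"
proof
  assume "simple_ideal alg I"
  then have I: "ideal I alg" "I \<noteq> {0\<^sub>m n n}"
    and min: "\<And>K. ideal K alg \<Longrightarrow> K \<subseteq> I \<Longrightarrow> K = {0\<^sub>m n n} \<or> K = I"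
    by (auto simp: simple_ideal_def ring_mat_simps)
  obtain j where j: "j \<in> J" "block j \<subseteq> I" using nonzero_ideal_contains_block[OF I] .
  have "block j \<noteq> {0\<^sub>m n n}" using U_in_block[OF j(1)] U_nonzero[OF j(1)] by auto
  then show "\<exists>j\<in>J. I = block j" using min[OF ideal_block[OF j(1)] j(2)] j by auto
next
  assume "\<exists>j\<in>J. I = block j"
  then obtain j where j: "j \<in> J" and I: "I = block j" by auto
  have nz: "block j \<noteq> {0\<^sub>m n n}" using U_in_block[OF j] U_nonzero[OF j] by auto
  have "K = block j" if K: "ideal K alg" "K \<subseteq> block j" "K \<noteq> {0\<^sub>m n n}" for K
  proof -
    obtain k where k: "k \<in> J" "block k \<subseteq> K" using nonzero_ideal_contains_block[OF K(1,3)] .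
    then have "k = j" using block_eq_if_subset[OF j k(1)] K by auto
    then show ?thesis using k K by auto
  qed
  then show "simple_ideal alg I"
    using nz ideal_block[OF j] by (auto simp: simple_ideal_def ring_mat_simps I)
qed

lemma ideal_identity_block_iff:
  assumes j: "j \<in> J"
  shows "ideal_identity alg (block j) V \<longleftrightarrow> V = U j"
  using U_neutral[OF j] U_in_block[OF j]
  by (auto simp: ideal_identity_def ring_mat_simps)

lemma inj_on_U: "inj_on U J"
proof (rule inj_onI)
  fix j k assume *: "j \<in> J" "k \<in> J" "U j = U k"
  show "j = k"
  proof (rule ccontr)
    assume "j \<noteq> k"
    then have "U j * U k = 0\<^sub>m n n"
      using * by (intro block_mult_distinct[of j k] U_in_block) auto
    then show False
      using U_neutral[OF *(1) U_in_block[OF *(1)]] U_nonzero[OF *(1)] *(3) by simp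
  qed
qed

theorem complete_orthogonal_idempotents_U: "complete_orthogonal_idempotents alg (U ` J)"
proof -
  interpret A: ring alg by (rule ring_alg)
  have UA: "U j \<in> generated_algebra n (P ` carrier G)" if "j \<in> J" for j
    using U_in_block[OF that] block_in_alg[OF that] by auto
  have "finsum alg (\<lambda>V. V) (U ` J) = finsum alg U J"
    using UA inj_on_U by (intro A.finsum_reindex) auto
  also have "\<dots> = mat n n (\<lambda>(a, b). \<Sum>j\<in>J. U j $$ (a, b))"
    using UA alg_carrier finite_J by (intro index_finsum_mat A.abelian_monoid_axioms) auto
  also have "\<dots> = 1\<^sub>m n"
    using complete by (intro eq_matI) auto
  finally have sum: "finsum alg (\<lambda>V. V) (U ` J) = 1\<^sub>m n" .
  have "{V. \<exists>I. simple_ideal alg I \<and> ideal_identity alg I V} = U ` J"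
    by (auto simp: simple_ideal_iff ideal_identity_block_iff)
  moreover have "\<exists>V. ideal_identity alg I V" if "simple_ideal alg I" for I
    using that by (auto simp: simple_ideal_iff ideal_identity_block_iff)
  moreover have "U j * U j = U j" if "j \<in> J" for j
    using U_neutral[OF that U_in_block[OF that]] by simp
  moreover have "U j * U k = 0\<^sub>m n n" if "j \<in> J" "k \<in> J" "U j \<noteq> U k" for j k
    using that U_in_block by (intro block_mult_distinct[of j k]) auto
  ultimately show ?thesis
    using sum finite_J unfolding complete_orthogonal_idempotents_def
    by (auto simp: ring_mat_simps)
qed

lemma \<rho>_eq_compress:
  assumes j: "j \<in> J" and g: "g \<in> carrier G"
  shows "B' j * P g * B j = \<rho> j g"
proof -
  have "B' j * P g * B j = B' j * (P g * B j)"
    using j by (simp add: mat_assoc carrier_matD[OF P_carrier[OF g]])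
  also have "\<dots> = \<rho> j g"
    unfolding intertwines[OF j g] using j by (simp add: carrier_matD[OF \<rho>_carrier[OF j g]])
  finally show ?thesis .
qed

lemma \<rho>_mult:
  assumes j: "j \<in> J" and g: "g \<in> carrier G" and h: "h \<in> carrier G"
  shows "\<rho> j (g \<otimes> h) = \<rho> j g * \<rho> j h"
proof -
  note [simp] = carrier_matD[OF \<rho>_carrier[OF j g]] carrier_matD[OF \<rho>_carrier[OF j h]]
    carrier_matD[OF P_carrier[OF g]] carrier_matD[OF P_carrier[OF h]]
  have "\<rho> j (g \<otimes> h) = B' j * (P g * (P h * B j))"
    using \<rho>_eq_compress[OF j m_closed[OF g h]] P_mult[OF g h] j by (simp add: mat_assoc)
  also have "P g * (P h * B j) = P g * B j * \<rho> j h"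
    unfolding intertwines[OF j h] using j by (simp add: mat_assoc)
  also have "B' j * (P g * B j * \<rho> j h) = \<rho> j g * \<rho> j h"
    unfolding intertwines[OF j g] using j by (simp add: mat_assoc)
  finally show ?thesis .
qed

lemma \<rho>_one: "j \<in> J \<Longrightarrow> \<rho> j \<one> = 1\<^sub>m (d j)"
  using \<rho>_eq_compress[of j \<one>] B_carrier[of j] B'_carrier[of j] left_inverse[of j]
  by (simp add: P_one)

text \<open>Used both for \<open>P\<close> and for the \<open>\<rho> j\<close>, whose inverses in the matrix rings it identifies.\<close>

lemma inv_cmat_hom:
  assumes carr: "\<And>g. g \<in> carrier G \<Longrightarrow> Q g \<in> carrier_mat r r"
    and mult: "\<And>g h. g \<in> carrier G \<Longrightarrow> h \<in> carrier G \<Longrightarrow> Q (g \<otimes> h) = Q g * Q h"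
    and one: "Q \<one> = 1\<^sub>m r" and h: "h \<in> carrier G"
  shows "inv\<^bsub>cmat_ring r\<^esub> (Q h) = Q (inv h)" and "Q h \<in> Units (cmat_ring r)"
proof -
  interpret M: ring "cmat_ring r" by (rule ring_mat)
  have 1: "Q h * Q (inv h) = 1\<^sub>m r" "Q (inv h) * Q h = 1\<^sub>m r"
    using mult[of h "inv h"] mult[of "inv h" h] h one by simp_all
  then show "inv\<^bsub>cmat_ring r\<^esub> (Q h) = Q (inv h)"
    using carr h by (intro M.inv_char) (auto simp: ring_mat_simps)
  show "Q h \<in> Units (cmat_ring r)"
    using 1 carr h inv_closed by (auto simp: Units_def ring_mat_simps)
qed

lemma representation_\<rho>:
  assumes j: "j \<in> J"
  shows "representation G (d j) (\<rho> j)"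
  unfolding representation_def hom_def
  using inv_cmat_hom(2)[OF \<rho>_carrier[OF j] \<rho>_mult[OF j] \<rho>_one[OF j]]
  by (auto simp: units_of_def ring_mat_simps \<rho>_mult[OF j])

text \<open>A subspace that is invariant under the group is invariant under the compressed algebra,
  which by \<open>full\<close> consists of all matrices.\<close>

lemma irreducible_\<rho>:
  assumes j: "j \<in> J"
  shows "irreducible_representation G (d j) (\<rho> j)"
  unfolding irreducible_representation_def
proof (intro conjI allI impI)
  show "representation G (d j) (\<rho> j)" using j by (rule representation_\<rho>)
  show "0 < d j" using j by (rule d_pos)
  fix W assume W: "VectorSpace.subspace class_ring W (module_vec TYPE(complex) (d j))"
    and inv: "\<forall>g\<in>carrier G. \<forall>w\<in>W. \<rho> j g *\<^sub>v w \<in> W"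
  note c = B_carrier[OF j] B'_carrier[OF j]
  have sub: "submodule class_ring W (module_vec TYPE(complex) (d j))"
    using W by (auto simp: VectorSpace.subspace_def)
  interpret W: submodule class_ring W "module_vec TYPE(complex) (d j)" by fact
  have Wc: "W \<subseteq> carrier_vec (d j)" using W.subset by (simp add: module_vec_simps)
  have W0: "0\<^sub>v (d j) \<in> W" using W.zero_closed by (simp add: module_vec_simps)
  have Wadd: "v + w \<in> W" if "v \<in> W" "w \<in> W" for v w
    using W.m_closed[OF that] by (simp add: module_vec_simps)
  have Wsmult: "a \<cdot>\<^sub>v w \<in> W" if "w \<in> W" for a w
    using W.smult_closed[OF _ that, of a] by (simp add: module_vec_simps class_ring_simps)
  have alg_inv: "\<forall>w\<in>W. (B' j * M * B j) *\<^sub>v w \<in> W"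
    if "M \<in> generated_algebra n (P ` carrier G)" for M
    using that
  proof induction
    case zero
    have "B' j * 0\<^sub>m n n * B j = 0\<^sub>m (d j) (d j)" using j by simp
    moreover have "0\<^sub>m (d j) (d j) *\<^sub>v w = 0\<^sub>v (d j)" if "w \<in> W" for w
      using that Wc by (intro eq_vecI) (auto simp: scalar_prod_def)
    ultimately show ?case using W0 by simp
  next
    case (gen A)
    then show ?case using inv \<rho>_eq_compress[OF j] by auto
  next
    case (add A C)
    then have AC: "A \<in> carrier_mat n n" "C \<in> carrier_mat n n" using alg_carrier by auto
    have "B' j * (A + C) * B j = B' j * A * B j + B' j * C * B j"
      using j by (simp add: mat_distribs carrier_matD[OF AC(1)] carrier_matD[OF AC(2)])
    moreover have "(B' j * A * B j + B' j * C * B j) *\<^sub>v w = (B' j * A * B j) *\<^sub>v w + (B' j * C * B j) *\<^sub>v w"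
      if "w \<in> W" for w
      using that Wc c AC by (intro add_mult_distrib_mat_vec) auto
    ultimately show ?case using add Wadd by simp
  next
    case (smult A a)
    then have A: "A \<in> carrier_mat n n" using alg_carrier by auto
    have "B' j * (a \<cdot>\<^sub>m A) * B j = a \<cdot>\<^sub>m (B' j * A * B j)"
      using j by (simp add: mat_distribs carrier_matD[OF A])
    moreover have "(a \<cdot>\<^sub>m (B' j * A * B j)) *\<^sub>v w = a \<cdot>\<^sub>v ((B' j * A * B j) *\<^sub>v w)" if "w \<in> W" for w
      using subsetD[OF Wc that] j
      by (intro eq_vecI) (auto simp: scalar_prod_def sum_distrib_left mult.assoc intro!: sum.cong)
    ultimately show ?case using smult Wsmult by simp
  next
    case (mult A C)
    then have AC: "A \<in> carrier_mat n n" "C \<in> carrier_mat n n" using alg_carrier by auto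
    let ?A = "B' j * A * B j" and ?C = "B' j * C * B j"
    note [simp] = carrier_matD[OF AC(1)] carrier_matD[OF AC(2)]
    have "B' j * (A * C) * B j = B' j * (A * (C * B j))"
      using j by (simp add: mat_assoc)
    also have "\<dots> = B' j * (A * (B j * ?C))" using compress_right[OF mult.hyps(2) j] by simp
    also have "\<dots> = ?A * ?C" using j by (simp add: mat_assoc)
    finally have "B' j * (A * C) * B j = ?A * ?C" .
    moreover have "(?A * ?C) *\<^sub>v w = ?A *\<^sub>v (?C *\<^sub>v w)" if "w \<in> W" for w
      by (rule assoc_mult_mat_vec[of _ "d j" "d j" _ "d j"]) (use that Wc j in auto)
    ultimately show ?case using mult.IH by simp
  qed
  show "W = {0\<^sub>v (d j)} \<or> W = carrier_vec (d j)"
  proof (cases "W = {0\<^sub>v (d j)}")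
    case False
    then obtain w where w: "w \<in> W" "w \<noteq> 0\<^sub>v (d j)" using W0 by auto
    have "v \<in> W" if v: "v \<in> carrier_vec (d j)" for v
    proof -
      obtain X where X: "X \<in> carrier_mat (d j) (d j)" "X *\<^sub>v w = v"
        using vec_in_mat_orbit[OF _ w(2) v] w(1) Wc by blast
      show ?thesis
        using alg_inv[OF full[OF j X(1)]] w(1) X(2) compress_of_expand[OF j X(1)] by auto
    qed
    then show ?thesis using Wc by auto
  qed simp
qed

text \<open>The isomorphism is the compression \<open>M \<mapsto> B' j * M * B j\<close>, with inverse \<open>X \<mapsto> B j * X * B' j\<close>.\<close>

theorem block_iso_Hom:
  assumes j: "j \<in> J"
  shows "\<exists>I. simple_ideal alg I \<and> ideal_identity alg I (U j) \<and>
       (\<exists>f. bij_betw f I (carrier_mat (d j) (d j)) \<and>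
            (\<forall>M\<in>I. \<forall>N\<in>I. f (M + N) = f M + f N) \<and>
            (\<forall>c. \<forall>M\<in>I. f (c \<cdot>\<^sub>m M) = c \<cdot>\<^sub>m f M) \<and>
            (\<forall>g\<in>carrier G. \<forall>h\<in>carrier G. \<forall>M\<in>I.
               f (P g * M * inv\<^bsub>cmat_ring n\<^esub> (P h)) =
               \<rho> j g * f M * inv\<^bsub>cmat_ring (d j)\<^esub> (\<rho> j h)))"
proof (intro exI conjI ballI allI)
  let ?f = "\<lambda>M. B' j * M * B j"
  have Ic: "M \<in> carrier_mat n n" if "M \<in> block j" for M
    using that block_in_alg[OF j] alg_carrier by auto
  show "simple_ideal alg (block j)" using j by (auto simp: simple_ideal_iff)
  show "ideal_identity alg (block j) (U j)" using j by (simp add: ideal_identity_block_iff)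
  show "bij_betw ?f (block j) (carrier_mat (d j) (d j))"
    by (rule bij_betw_byWitness[where f' = "\<lambda>X. B j * X * B' j"])
      (use j in \<open>auto simp: block_def compress_of_expand\<close>)
  show "?f (M + N) = ?f M + ?f N" if "M \<in> block j" "N \<in> block j" for M N
    using j by (simp add: mat_distribs carrier_matD[OF Ic[OF that(1)]] carrier_matD[OF Ic[OF that(2)]])
  show "?f (a \<cdot>\<^sub>m M) = a \<cdot>\<^sub>m ?f M" if "M \<in> block j" for a M
    using j by (simp add: mat_distribs carrier_matD[OF Ic[OF that]])
  show "?f (P g * M * inv\<^bsub>cmat_ring n\<^esub> (P h)) = \<rho> j g * ?f M * inv\<^bsub>cmat_ring (d j)\<^esub> (\<rho> j h)"
    if g: "g \<in> carrier G" and h: "h \<in> carrier G" and M: "M \<in> block j" for g h M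
  proof -
    obtain X where X: "X \<in> carrier_mat (d j) (d j)" "M = B j * X * B' j"
      using M by (auto simp: block_def)
    have gA: "P x \<in> generated_algebra n (P ` carrier G)" if "x \<in> carrier G" for x
      using that by (auto intro: generated_algebra.gen)
    let ?Y = "\<rho> j g * X" and ?h = "inv h"
    have Y: "?Y \<in> carrier_mat (d j) (d j)" "\<rho> j ?h \<in> carrier_mat (d j) (d j)"
      using \<rho>_carrier[OF j g] \<rho>_carrier[OF j, of ?h] X h by auto
    have "P g * M * P ?h = B j * (?Y * \<rho> j ?h) * B' j"
      using alg_times_block(1)[OF gA[OF g] j X(1)] alg_times_block(2)[OF gA[of ?h] j Y(1)] h
      by (simp add: X(2) \<rho>_eq_compress[OF j] g)
    then have "?f (P g * M * P ?h) = ?Y * \<rho> j ?h"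
      using compress_of_expand[OF j, of "?Y * \<rho> j ?h"] Y by auto
    moreover have "?f M = X" using compress_of_expand[OF j X(1)] X(2) by simp
    ultimately show ?thesis
      using inv_cmat_hom(1)[OF P_carrier P_mult P_one h]
        inv_cmat_hom(1)[OF \<rho>_carrier[OF j] \<rho>_mult[OF j] \<rho>_one[OF j] h] by simp
  qed
qed

end

section \<open>The dihedral group and its permutation matrices\<close>

lemma perm_mat_carrier [simp]: "perm_mat n \<sigma> \<in> carrier_mat n n"
  by (simp add: perm_mat_def mat_from1_def)

lemma perm_mat_dims [simp]: "dim_row (perm_mat n \<sigma>) = n" "dim_col (perm_mat n \<sigma>) = n"
  by (simp_all add: perm_mat_def mat_from1_def)

lemma perm_mat_index:
  "a < n \<Longrightarrow> b < n \<Longrightarrow> perm_mat n \<sigma> $$ (a, b) = (if \<sigma> (Suc b) = Suc a then 1 else 0)"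
  by (simp add: perm_mat_def mat_from1_def)

text \<open>A permutation matrix moves row \<open>i\<close> to row \<open>\<sigma> i\<close>; the index shift comes from permuting
  \<open>{1..n}\<close> while matrix rows are numbered from 0.\<close>

lemma perm_mat_mult_eq:
  assumes \<sigma>: "\<sigma> permutes {1..n}" and A: "A \<in> carrier_mat n r" and E: "E \<in> carrier_mat n r"
    and eq: "\<And>i q. i < n \<Longrightarrow> q < r \<Longrightarrow> E $$ (\<sigma> (Suc i) - 1, q) = A $$ (i, q)"
  shows "perm_mat n \<sigma> * A = E"
proof (rule eq_matI)
  fix a q assume "a < dim_row E" "q < dim_col E"
  then have aq: "a < n" "q < r" using E by auto
  have "Suc a \<in> \<sigma> ` {1..n}" using permutes_image[OF \<sigma>] aq by simp
  then obtain i where i: "i < n" "\<sigma> (Suc i) = Suc a"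
    by (metis (no_types, lifting) Suc_le_eq Suc_pred' atLeastAtMost_iff imageE less_eq_Suc_le One_nat_def)
  have inj: "\<sigma> (Suc c) = Suc a \<longleftrightarrow> c = i" for c
    using i(2) permutes_inj[OF \<sigma>] by (metis Suc_inject injD)
  have "(perm_mat n \<sigma> * A) $$ (a, q) = (\<Sum>c<n. perm_mat n \<sigma> $$ (a, c) * A $$ (c, q))"
    using aq A by (auto simp: scalar_prod_def atLeast0LessThan)
  also have "\<dots> = (\<Sum>c<n. if c = i then A $$ (c, q) else 0)"
    using aq by (intro sum.cong) (auto simp: perm_mat_index inj)
  also have "\<dots> = A $$ (i, q)" using i by simp
  finally show "(perm_mat n \<sigma> * A) $$ (a, q) = E $$ (a, q)" using eq[OF i(1) aq(2)] i(2) by simp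
qed (use A E in auto)

lemma perm_mat_comp:
  assumes "\<sigma> permutes {1..n}" and "\<tau> permutes {1..n}"
  shows "perm_mat n (\<sigma> \<circ> \<tau>) = perm_mat n \<sigma> * perm_mat n \<tau>"
proof (rule perm_mat_mult_eq[symmetric, OF assms(1)])
  fix i q assume iq: "i < n" "q < n"
  have "\<sigma> (Suc i) \<in> {1..n}" using permutes_in_image[OF assms(1), of "Suc i"] iq by simp
  then obtain e where e: "\<sigma> (Suc i) = Suc e" "e < n"
    by (metis One_nat_def Suc_le_eq Suc_pred' atLeastAtMost_iff)
  have "\<sigma> (\<tau> (Suc q)) = \<sigma> (Suc i) \<longleftrightarrow> \<tau> (Suc q) = Suc i"
    using permutes_inj[OF assms(1)] by (rule inj_eq)
  then show "perm_mat n (\<sigma> \<circ> \<tau>) $$ (\<sigma> (Suc i) - 1, q) = perm_mat n \<tau> $$ (i, q)"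
    using iq e(2) by (simp add: perm_mat_index e(1))
qed simp_all

lemma perm_mat_id: "perm_mat n id = 1\<^sub>m n"
  by (intro eq_matI) (auto simp: perm_mat_index)

lemma rot_perm_permutes: "rot_perm n permutes {1..n}"
proof (rule bij_imp_permutes)
  have "rot_perm n ` {1..n} = {1..n}"
  proof
    show "rot_perm n ` {1..n} \<subseteq> {1..n}" by (auto simp: rot_perm_def)
    have "x \<in> rot_perm n ` {1..n}" if "x \<in> {1..n}" for x
    proof (cases "x = 1")
      case True
      then show ?thesis using that by (intro image_eqI[of _ _ n]) (auto simp: rot_perm_def)
    next
      case False
      then show ?thesis using that by (intro image_eqI[of _ _ "x - 1"]) (auto simp: rot_perm_def)
    qed
    then show "{1..n} \<subseteq> rot_perm n ` {1..n}" by blast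
  qed
  then show "bij_betw (rot_perm n) {1..n} {1..n}"
    by (simp add: bij_betw_def eq_card_imp_inj_on)
qed (auto simp: rot_perm_def)

lemma refl_perm_permutes: "refl_perm n permutes {1..n}"
  by (rule bij_imp_permutes, rule bij_betw_byWitness[where f' = "refl_perm n"])
    (auto simp: refl_perm_def)

lemma rot_pow_permutes: "(rot_perm n ^^ k) permutes {1..n}"
proof (induction k)
  case 0
  show ?case using permutes_id[of "{1..n}"] by (simp add: id_def)
next
  case (Suc k)
  show ?case using permutes_compose[OF Suc rot_perm_permutes] by (simp only: funpow.simps)
qed

lemma rot_pow_Suc_apply:
  assumes "i < n"
  shows "(rot_perm n ^^ k) (Suc i) = Suc ((i + k) mod n)"
proof (induction k)
  case 0
  then show ?case using assms by simp
next
  case (Suc k)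
  have "(i + k) mod n < n" using assms by simp
  then show ?case using Suc by (auto simp: rot_perm_def mod_Suc)
qed

lemma rot_pow_n: "rot_perm n ^^ n = id"
proof
  fix x show "(rot_perm n ^^ n) x = id x"
  proof (cases "x \<in> {1..n}")
    case True
    then obtain i where "x = Suc i" "i < n" by (metis Suc_le_eq atLeastAtMost_iff not0_implies_Suc not_one_le_zero)
    then show ?thesis by (simp add: rot_pow_Suc_apply)
  next
    case False
    then show ?thesis using permutes_not_in[OF rot_pow_permutes] by simp
  qed
qed

lemma rot_pow_eq_iff:
  assumes "n > 0"
  shows "rot_perm n ^^ k = rot_perm n ^^ l \<longleftrightarrow> k mod n = l mod n"
proof
  assume "rot_perm n ^^ k = rot_perm n ^^ l"
  then have "(rot_perm n ^^ k) (Suc 0) = (rot_perm n ^^ l) (Suc 0)" by simp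
  then show "k mod n = l mod n" using assms by (simp only: rot_pow_Suc_apply) simp
next
  assume *: "k mod n = l mod n"
  have "rot_perm n ^^ k = rot_perm n ^^ (k mod n)" for k
    by (metis div_mult_mod_eq funpow_add funpow_mult rot_pow_n id_funpow id_comp mult.commute)
  then show "rot_perm n ^^ k = rot_perm n ^^ l" using * by metis
qed

lemma refl_perm_refl_perm: "refl_perm n \<circ> refl_perm n = id"
  by (auto simp: refl_perm_def fun_eq_iff)

lemma rot_refl_rot: "rot_perm n \<circ> refl_perm n \<circ> rot_perm n = refl_perm n"
  by (auto simp: refl_perm_def rot_perm_def fun_eq_iff)

lemma rot_pow_refl: "\<exists>l. rot_perm n ^^ k \<circ> refl_perm n = refl_perm n \<circ> rot_perm n ^^ l"
proof (induction k)
  case (Suc k)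
  then obtain l where l: "rot_perm n ^^ k \<circ> refl_perm n = refl_perm n \<circ> rot_perm n ^^ l" by blast
  let ?R = "rot_perm n" and ?C = "refl_perm n"
  have 1: "?R \<circ> ?C = ?C \<circ> ?R ^^ (n - 1)"
  proof (cases n)
    case 0
    then show ?thesis by (auto simp: refl_perm_def rot_perm_def fun_eq_iff)
  next
    case (Suc n')
    have "?R \<circ> ?C = ?R \<circ> ?C \<circ> ?R ^^ Suc n'"
      using rot_pow_n[of n] Suc by simp
    also have "\<dots> = (?R \<circ> ?C \<circ> ?R) \<circ> ?R ^^ n'" by (simp add: comp_assoc)
    finally show ?thesis using Suc by (simp only: rot_refl_rot) simp
  qed
  have "?R ^^ Suc k \<circ> ?C = ?R \<circ> (?R ^^ k \<circ> ?C)" by (simp add: comp_assoc)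
  also have "\<dots> = (?R \<circ> ?C) \<circ> ?R ^^ l" by (simp add: l comp_assoc)
  also have "\<dots> = ?C \<circ> ?R ^^ (n - 1 + l)" by (simp only: 1 comp_assoc funpow_add)
  finally show ?case by blast
qed (auto intro!: exI[of _ 0])

text \<open>Rotations commute with the basic rotation. A reflection does not: at the point that the
  rotation sends to 1, the two orders of composition give \<open>n - 1\<close> and \<open>1\<close>, which differ
  when \<open>n \<ge> 3\<close>.\<close>

lemma refl_rot_not_rot:
  assumes "n \<ge> 3"
  shows "refl_perm n \<circ> rot_perm n ^^ k \<noteq> rot_perm n ^^ l"
proof
  assume eq: "refl_perm n \<circ> rot_perm n ^^ k = rot_perm n ^^ l"
  have comm: "(refl_perm n \<circ> rot_perm n ^^ k) \<circ> rot_perm n = rot_perm n \<circ> (refl_perm n \<circ> rot_perm n ^^ k)"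
    unfolding eq by (simp add: funpow_swap1 fun_eq_iff)
  obtain x where x: "(rot_perm n ^^ k) x = 1"
    using surjD[OF permutes_surj[OF rot_pow_permutes], of 1 k n] by metis
  have "(rot_perm n ^^ k) (rot_perm n x) = 2"
    using x assms funpow_swap1[of "rot_perm n" k x] by (simp add: rot_perm_def)
  then have "refl_perm n 2 = rot_perm n (refl_perm n 1)"
    using fun_cong[OF comm, of x] x by (simp only: comp_apply)
  then show False using assms by (auto simp: refl_perm_def rot_perm_def)
qed

lemma dihedral_simps:
  "mult (dihedral n) = (\<circ>)" "one (dihedral n) = id"
  by (simp_all add: dihedral_def sym_group_def)

lemma subgroup_dihedral: "subgroup (carrier (dihedral n)) (sym_group n)"
  unfolding dihedral_def
  using group.generate_is_subgroup[OF sym_group_is_group, of "{rot_perm n, refl_perm n}" n]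
  by (simp add: sym_group_carrier rot_perm_permutes refl_perm_permutes del: One_nat_def)

lemma group_dihedral: "group (dihedral n)"
  using subgroup.subgroup_is_group[OF subgroup_dihedral sym_group_is_group]
  by (simp add: dihedral_def)

lemma dihedral_permutes: "\<sigma> \<in> carrier (dihedral n) \<Longrightarrow> \<sigma> permutes {1..n}"
  using subgroup.subset[OF subgroup_dihedral] sym_group_carrier by blast

lemma rot_pow_in_dihedral: "rot_perm n ^^ k \<in> carrier (dihedral n)"
proof (induction k)
  case 0
  show ?case
    using monoid.one_closed[OF group.is_monoid[OF group_dihedral], of n]
    by (simp only: dihedral_simps funpow.simps)
next
  case (Suc k)
  have "rot_perm n \<in> carrier (dihedral n)" by (auto simp: dihedral_def intro: generate.incl)
  then show ?case
    using monoid.m_closed[OF group.is_monoid[OF group_dihedral], of "rot_perm n" n "rot_perm n ^^ k"] Suc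
    by (simp only: dihedral_simps funpow.simps)
qed

lemma refl_rot_pow_in_dihedral: "refl_perm n \<circ> rot_perm n ^^ k \<in> carrier (dihedral n)"
proof -
  have "refl_perm n \<in> carrier (dihedral n)" by (auto simp: dihedral_def intro: generate.incl)
  then show ?thesis
    using monoid.m_closed[OF group.is_monoid[OF group_dihedral] _ rot_pow_in_dihedral, of "refl_perm n" n k]
    by (simp only: dihedral_simps)
qed

lemma dihedral_cases:
  assumes "\<sigma> \<in> carrier (dihedral n)"
  obtains (rotation) k where "\<sigma> = rot_perm n ^^ k"
    | (reflection) k where "\<sigma> = refl_perm n \<circ> rot_perm n ^^ k"
proof -
  let ?R = "rot_perm n" and ?C = "refl_perm n"
  interpret S: group "sym_group n" by (rule sym_group_is_group)
  have "\<sigma> \<in> generate (sym_group n) {?R, ?C}" using assms by (simp add: dihedral_def)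
  then have "(\<exists>k. \<sigma> = ?R ^^ k) \<or> (\<exists>k. \<sigma> = ?C \<circ> ?R ^^ k)"
  proof induction
    case one
    then show ?case by (auto simp: sym_group_one intro!: exI[of _ 0])
  next
    case (incl h)
    then show ?case by (auto intro: exI[of _ 0] exI[of _ 1])
  next
    case (inv h)
    have "inv\<^bsub>sym_group n\<^esub> ?R = ?R ^^ (n - 1)"
    proof (rule S.inv_equality)
      have "?R ^^ (n - 1) \<circ> ?R = id"
      proof (cases n)
        case 0
        then show ?thesis by (auto simp: rot_perm_def fun_eq_iff)
      next
        case (Suc n')
        then show ?thesis using rot_pow_n[of n] by (simp add: funpow_Suc_right del: funpow.simps)
      qed
      then show "?R ^^ (n - 1) \<otimes>\<^bsub>sym_group n\<^esub> ?R = \<one>\<^bsub>sym_group n\<^esub>"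
        by (simp add: sym_group_mult sym_group_one)
    qed (simp_all add: sym_group_carrier rot_perm_permutes rot_pow_permutes del: One_nat_def)
    moreover have "inv\<^bsub>sym_group n\<^esub> ?C = ?C"
      by (rule S.inv_equality)
        (simp_all add: sym_group_carrier refl_perm_permutes sym_group_mult sym_group_one refl_perm_refl_perm
          del: One_nat_def)
    ultimately show ?case using inv by (auto intro: exI[of _ 0])
  next
    case (eng g h)
    have RR: "?R ^^ k \<circ> ?R ^^ l = ?R ^^ (k + l)" for k l by (simp add: funpow_add)
    from eng.IH show ?case
    proof (elim disjE exE)
      fix k l assume gh: "g = ?R ^^ k" "h = ?R ^^ l"
      then show ?thesis by (auto simp: sym_group_mult RR)
    next
      fix k l assume gh: "g = ?R ^^ k" "h = ?C \<circ> ?R ^^ l"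
      obtain k' where k': "?R ^^ k \<circ> ?C = ?C \<circ> ?R ^^ k'" using rot_pow_refl by blast
      have "g \<circ> h = (?R ^^ k \<circ> ?C) \<circ> ?R ^^ l" by (simp add: gh comp_assoc)
      also have "\<dots> = ?C \<circ> ?R ^^ (k' + l)" by (simp only: k' comp_assoc RR)
      finally show ?thesis by (auto simp: sym_group_mult)
    next
      fix k l assume gh: "g = ?C \<circ> ?R ^^ k" "h = ?R ^^ l"
      then have "g \<circ> h = ?C \<circ> ?R ^^ (k + l)" by (simp only: comp_assoc RR)
      then show ?thesis by (auto simp: sym_group_mult)
    next
      fix k l assume gh: "g = ?C \<circ> ?R ^^ k" "h = ?C \<circ> ?R ^^ l"
      obtain k' where k': "?R ^^ k \<circ> ?C = ?C \<circ> ?R ^^ k'" using rot_pow_refl by blast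
      have "g \<circ> h = ?C \<circ> (?R ^^ k \<circ> ?C) \<circ> ?R ^^ l" by (simp add: gh comp_assoc)
      also have "\<dots> = (?C \<circ> ?C) \<circ> (?R ^^ k' \<circ> ?R ^^ l)" by (simp only: k' comp_assoc)
      also have "\<dots> = ?R ^^ (k' + l)" by (simp only: refl_perm_refl_perm RR id_comp)
      finally show ?thesis by (auto simp: sym_group_mult)
    qed
  qed
  then show thesis using that by blast
qed

lemma representation_perm_mat: "representation (dihedral n) n (perm_mat n)"
proof -
  interpret D: group "dihedral n" by (rule group_dihedral)
  have mult: "perm_mat n (\<sigma> \<circ> \<tau>) = perm_mat n \<sigma> * perm_mat n \<tau>"
    if "\<sigma> \<in> carrier (dihedral n)" "\<tau> \<in> carrier (dihedral n)" for \<sigma> \<tau>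
    using that by (intro perm_mat_comp dihedral_permutes)
  have "perm_mat n \<sigma> \<in> Units (cmat_ring n)" if "\<sigma> \<in> carrier (dihedral n)" for \<sigma>
  proof -
    have "\<sigma> \<circ> inv\<^bsub>dihedral n\<^esub> \<sigma> = id" "inv\<^bsub>dihedral n\<^esub> \<sigma> \<circ> \<sigma> = id"
      using D.r_inv[OF that] D.l_inv[OF that] by (simp_all add: dihedral_simps)
    then have "perm_mat n \<sigma> * perm_mat n (inv\<^bsub>dihedral n\<^esub> \<sigma>) = 1\<^sub>m n"
      "perm_mat n (inv\<^bsub>dihedral n\<^esub> \<sigma>) * perm_mat n \<sigma> = 1\<^sub>m n"
      using mult[OF that D.inv_closed[OF that]] mult[OF D.inv_closed[OF that] that]
      by (simp_all add: perm_mat_id)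
    then show ?thesis by (auto simp: Units_def ring_mat_simps)
  qed
  then show ?thesis
    unfolding representation_def hom_def
    by (auto simp: units_of_def ring_mat_simps dihedral_simps mult)
qed

lemma is_rotation_values:
  assumes "n \<ge> 3"
  shows "is_rotation n (rot_perm n ^^ k)" and "\<not> is_rotation n (refl_perm n \<circ> rot_perm n ^^ k)"
  using refl_rot_not_rot[OF assms] by (auto simp: is_rotation_def)

text \<open>Functions that depend on the exponent only modulo \<open>n\<close> can be evaluated with this congruence,
  whichever exponent is the least one.\<close>

lemma dih_exp_mod:
  assumes n: "n \<ge> 3"
  shows "dih_exp n (rot_perm n ^^ k) mod n = k mod n"
    and "dih_exp n (refl_perm n \<circ> rot_perm n ^^ k) mod n = k mod n"
proof -
  let ?R = "rot_perm n" and ?C = "refl_perm n"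
  have LI: "\<sigma> = ?R ^^ dih_exp n \<sigma> \<or> \<sigma> = ?C \<circ> ?R ^^ dih_exp n \<sigma>"
    if "\<sigma> = ?R ^^ k \<or> \<sigma> = ?C \<circ> ?R ^^ k" for \<sigma>
    unfolding dih_exp_def
    using LeastI[of "\<lambda>k. \<sigma> = ?R ^^ k \<or> \<sigma> = ?C \<circ> ?R ^^ k", OF that] .
  have "?R ^^ k = ?R ^^ dih_exp n (?R ^^ k)"
    using LI[of "?R ^^ k"] refl_rot_not_rot[OF n, of "dih_exp n (?R ^^ k)" k] by metis
  then show "dih_exp n (?R ^^ k) mod n = k mod n"
    using rot_pow_eq_iff[of n k] n by simp
  have "?C \<circ> ?R ^^ k = ?C \<circ> ?R ^^ dih_exp n (?C \<circ> ?R ^^ k)"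
    using LI[of "?C \<circ> ?R ^^ k"] refl_rot_not_rot[OF n, of k] by metis
  then have "?C \<circ> ?C \<circ> ?R ^^ k = ?C \<circ> ?C \<circ> ?R ^^ dih_exp n (?C \<circ> ?R ^^ k)"
    by (metis comp_assoc)
  then have "?R ^^ k = ?R ^^ dih_exp n (?C \<circ> ?R ^^ k)" by (simp add: refl_perm_refl_perm)
  then show "dih_exp n (?C \<circ> ?R ^^ k) mod n = k mod n"
    using rot_pow_eq_iff[of n k] n by simp
qed

lemma det_perm_mat_swap:
  assumes "a < n" "b < n" "a \<noteq> b"
  shows "det (perm_mat n (transpose (Suc a) (Suc b))) = -1"
proof -
  have "perm_mat n (transpose (Suc a) (Suc b)) = swaprows_mat n a b"
    using assms by (intro eq_matI) (auto simp: perm_mat_index transpose_def swaprows_mat_def)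
  then show ?thesis using det_swaprows_mat[OF assms] by simp
qed

lemma det_perm_mat_comp:
  assumes "\<sigma> permutes {1..n}" and "\<tau> permutes {1..n}"
  shows "det (perm_mat n (\<sigma> \<circ> \<tau>)) = det (perm_mat n \<sigma>) * det (perm_mat n \<tau>)"
  using perm_mat_comp[OF assms] by (simp add: det_mult[of _ n])

text \<open>Induction on the length of the cycle inside a fixed \<open>n\<close>: the \<open>(k + 2)\<close>-cycle is the
  \<open>(k + 1)\<close>-cycle followed by the transposition of \<open>1\<close> and \<open>k + 2\<close>.\<close>

lemma det_perm_mat_rot_perm:
  "Suc k \<le> n \<Longrightarrow> det (perm_mat n (rot_perm (Suc k))) = (-1) ^ k"
proof (induction k)
  case 0
  have "rot_perm (Suc 0) = id" by (auto simp: rot_perm_def)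
  then show ?case by (simp only: perm_mat_id det_one power_0)
next
  case (Suc k)
  have "rot_perm (Suc (Suc k)) = transpose (Suc 0) (Suc (Suc k)) \<circ> rot_perm (Suc k)"
    by (auto simp: rot_perm_def transpose_def fun_eq_iff)
  moreover have "rot_perm (Suc k) permutes {1..n}"
    using permutes_subset[OF rot_perm_permutes[of "Suc k"]] Suc.prems by auto
  moreover have "transpose (Suc 0) (Suc (Suc k)) permutes {1..n}"
    using Suc.prems by (intro permutes_swap_id) auto
  ultimately show ?case
    using Suc det_perm_mat_swap[of 0 n "Suc k"] by (simp only: det_perm_mat_comp) simp
qed

text \<open>The reflection is a product of \<open>m\<close> disjoint transpositions.\<close>

lemma det_perm_mat_refl_perm: "det (perm_mat (2 * m) (refl_perm (2 * m))) = (-1) ^ m"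
proof -
  define n where "n = 2 * m"
  \<comment> \<open>\<open>F k\<close> reflects the outermost \<open>k\<close> pairs and fixes the rest.\<close>
  define F where "F k i = (if i \<in> {1..n} \<and> (i \<le> k \<or> n - k < i) then n + 1 - i else i)" for k i :: nat
  have main: "F k permutes {1..n} \<and> det (perm_mat n (F k)) = (-1) ^ k" if "k \<le> m" for k
    using that
  proof (induction k)
    case 0
    have "F 0 = id" by (auto simp: F_def fun_eq_iff)
    then show ?case by (simp only: perm_mat_id det_one power_0 permutes_id simp_thms)
  next
    case (Suc k)
    let ?t = "transpose (Suc k) (Suc (n - Suc k))"
    have t: "?t permutes {1..n}" using Suc.prems by (intro permutes_swap_id) (auto simp: n_def)
    have IH: "F k permutes {1..n}" "det (perm_mat n (F k)) = (-1) ^ k" using Suc by auto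
    have F: "F (Suc k) = ?t \<circ> F k"
    proof
      fix i
      have k: "2 * k < n" "2 * k + 1 < n" using Suc.prems by (auto simp: n_def)
      have S: "Suc (n - Suc k) = n - k" using k by simp
      consider "i = Suc k" | "i = n - k" | "i \<noteq> Suc k" "i \<noteq> n - k" by blast
      then show "F (Suc k) i = (?t \<circ> F k) i"
      proof cases
        case 1
        then have "F k i = i" "F (Suc k) i = n - k" using k by (auto simp: F_def)
        then show ?thesis using 1 by (simp add: S)
      next
        case 2
        then have "F k i = i" "F (Suc k) i = Suc k" using k by (auto simp: F_def)
        then show ?thesis using 2 by (simp add: S)
      next
        case 3
        then have "F (Suc k) i = F k i" using k by (auto simp: F_def)
        moreover have "F k i \<noteq> Suc k \<and> F k i \<noteq> Suc (n - Suc k)"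
          using 3 k by (simp add: F_def) linarith
        ultimately show ?thesis by (simp add: transpose_def)
      qed
    qed
    have "det (perm_mat n ?t) = -1"
      using Suc.prems by (intro det_perm_mat_swap) (auto simp: n_def)
    then show ?case
      unfolding F using IH t by (simp only: det_perm_mat_comp permutes_compose) simp
  qed
  have "F m = refl_perm n" by (auto simp: F_def refl_perm_def n_def fun_eq_iff)
  then show ?thesis using main[of m] by (simp add: n_def)
qed

text \<open>The reflection has determinant \<open>(-1) ^ m\<close>; for even \<open>m\<close> the factor \<open>chi_det\<close> supplies the
  missing sign, so \<open>\<chi>'\<close> is \<open>-1\<close> on both generators.\<close>

lemma chi_prime_values:
  assumes m: "m \<ge> 2"
  shows "chi_prime m (rot_perm (2 * m) ^^ k) = (-1) ^ k"
    and "chi_prime m (refl_perm (2 * m) \<circ> rot_perm (2 * m) ^^ k) = - ((-1) ^ k)"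
proof -
  let ?n = "2 * m"
  have R: "det (perm_mat ?n (rot_perm ?n)) = -1"
    using det_perm_mat_rot_perm[of "?n - 1" ?n] m by (simp add: power_minus_odd)
  have Rk: "det (perm_mat ?n (rot_perm ?n ^^ k)) = (-1) ^ k"
  proof (induction k)
    case 0
    show ?case by (simp only: funpow.simps perm_mat_id det_one power_0)
  next
    case (Suc k)
    then show ?case
      by (simp only: funpow.simps det_perm_mat_comp[OF rot_perm_permutes rot_pow_permutes] R power_Suc)
  qed
  have CRk: "det (perm_mat ?n (refl_perm ?n \<circ> rot_perm ?n ^^ k)) = (-1) ^ m * (-1) ^ k"
    by (simp add: det_perm_mat_comp[OF refl_perm_permutes rot_pow_permutes] Rk det_perm_mat_refl_perm)
  note rots = is_rotation_values[of ?n]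
  show "chi_prime m (rot_perm ?n ^^ k) = (-1) ^ k"
    using m rots(1) by (simp add: chi_prime_def chi_sgn_def chi_det_def Rk)
  show "chi_prime m (refl_perm ?n \<circ> rot_perm ?n ^^ k) = - ((-1) ^ k)"
    using m rots(2) by (simp add: chi_prime_def chi_sgn_def chi_det_def CRk)
qed

section \<open>Orthogonality of sampled cosines and sines\<close>

text \<open>The three sums telescope after multiplication by twice the sine of half the step.\<close>

lemma sum_cos_odd_multiples:
  fixes h :: real
  shows "2 * sin h * (\<Sum>i<N. cos (real (2 * i + 1) * h)) = sin (real (2 * N) * h)"
proof (induction N)
  case (Suc N)
  have "2 * sin h * cos (real (2 * N + 1) * h) = sin (real (2 * N + 1) * h + h) - sin (real (2 * N + 1) * h - h)"
    by (simp add: sin_add sin_diff)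
  also have "real (2 * N + 1) * h + h = real (2 * Suc N) * h" by (simp add: algebra_simps)
  also have "real (2 * N + 1) * h - h = real (2 * N) * h" by (simp add: algebra_simps)
  finally show ?case using Suc.IH by (simp add: algebra_simps)
qed simp

lemma sum_sin_odd_multiples:
  fixes h :: real
  shows "2 * sin h * (\<Sum>i<N. sin (real (2 * i + 1) * h)) = 1 - cos (real (2 * N) * h)"
proof (induction N)
  case (Suc N)
  have "2 * sin h * sin (real (2 * N + 1) * h) = cos (real (2 * N + 1) * h - h) - cos (real (2 * N + 1) * h + h)"
    by (simp add: cos_add cos_diff)
  also have "real (2 * N + 1) * h + h = real (2 * Suc N) * h" by (simp add: algebra_simps)
  also have "real (2 * N + 1) * h - h = real (2 * N) * h" by (simp add: algebra_simps)
  finally show ?case using Suc.IH by (simp add: algebra_simps)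
qed simp

lemma sum_cos_multiples:
  fixes x :: real
  shows "2 * sin (x / 2) * (\<Sum>k=1..N. cos (real k * x)) = sin ((real N + 1 / 2) * x) - sin (x / 2)"
proof (induction N)
  case (Suc N)
  have "2 * sin (x / 2) * cos (real (Suc N) * x) = sin (real (Suc N) * x + x / 2) - sin (real (Suc N) * x - x / 2)"
    by (simp add: sin_add sin_diff)
  also have "real (Suc N) * x + x / 2 = (real (Suc N) + 1 / 2) * x" by (simp add: algebra_simps)
  also have "real (Suc N) * x - x / 2 = (real N + 1 / 2) * x" by (simp add: algebra_simps)
  finally show ?case using Suc.IH by (simp add: algebra_simps)
qed simp

lemma sin_frac_pi_nonzero:
  fixes l :: int
  assumes "n > 0" and "\<not> int n dvd l"
  shows "sin (of_int l * (pi / real n)) \<noteq> 0"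
proof
  assume "sin (of_int l * (pi / real n)) = 0"
  then obtain i :: int where "of_int l * (pi / real n) = of_int i * pi"
    by (auto simp: sin_zero_iff_int2)
  then have "real_of_int l = of_int i * real n" using assms(1) by (simp add: field_simps)
  then have "real_of_int l = real_of_int (i * int n)" by simp
  then have "l = i * int n" by (simp only: of_int_eq_iff)
  then show False using assms(2) by simp
qed

lemma sum_cos_midpoints:
  fixes l :: int
  assumes n: "n > 0"
  shows "\<not> int n dvd l \<Longrightarrow> (\<Sum>i<n. cos (real (2 * i + 1) * (of_int l * (pi / real n)))) = 0"
    and "(\<Sum>i<n. sin (real (2 * i + 1) * (of_int l * (pi / real n)))) = 0"
proof -
  let ?h = "of_int l * (pi / real n)"
  have h: "real (2 * n) * ?h = 2 * pi * of_int l" using n by simp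
  show "(\<Sum>i<n. cos (real (2 * i + 1) * ?h)) = 0" if "\<not> int n dvd l"
    using sum_cos_odd_multiples[of ?h n] sin_frac_pi_nonzero[OF n that]
    unfolding h by (simp only: sin_int_2pin) auto
  show "(\<Sum>i<n. sin (real (2 * i + 1) * ?h)) = 0"
  proof (cases "int n dvd l")
    case True
    then obtain t where "l = int n * t" by (auto simp: dvd_def)
    then have "real (2 * i + 1) * ?h = of_int (int (2 * i + 1) * t) * pi" for i
      using n by simp
    then have "sin (real (2 * i + 1) * ?h) = 0" for i
      unfolding sin_zero_iff_int2 by blast
    then show ?thesis by simp
  next
    case False
    then show ?thesis
      using sum_sin_odd_multiples[of ?h n] sin_frac_pi_nonzero[OF n False]
      unfolding h by (simp only: cos_int_2pin) auto
  qed
qed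

text \<open>The sample points are the midpoints \<open>2 \<pi> (i + 1/2) / n\<close>, because the reflection, which takes
  \<open>i\<close> to \<open>n - 1 - i\<close>, then acts on angles as \<open>t \<mapsto> 2 \<pi> - t\<close>: cosines are even and sines odd.\<close>

definition angle :: "nat \<Rightarrow> nat \<Rightarrow> real" where
  "angle n i = real (2 * i + 1) * (pi / real n)"

text \<open>Frequency \<open>j\<close> contributes a cosine (\<open>q = 0\<close>) and a sine (\<open>q = 1\<close>) for \<open>0 < j < m\<close>. At the ends
  only one of them is nonzero at the midpoints: the constant 1 for \<open>j = 0\<close>, and the
  sine, which equals \<open>(-1) ^ i\<close>, for \<open>j = m\<close>; there it has index \<open>q = 0\<close>.\<close>

definition wave :: "nat \<Rightarrow> nat \<Rightarrow> nat \<Rightarrow> nat \<Rightarrow> real" where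
  "wave m j q i = (if q = 0 \<and> j < m then cos (real j * angle (2 * m) i) else sin (real j * angle (2 * m) i))"

definition wave_dim :: "nat \<Rightarrow> nat \<Rightarrow> nat" where
  "wave_dim m j = (if j = 0 \<or> j = m then 1 else 2)"

text \<open>Products of waves are sums of waves with frequencies \<open>j - k\<close> and \<open>j + k\<close>, and such a sum
  over the sample points vanishes unless \<open>2 m\<close> divides the frequency.\<close>

lemma wave_gram:
  assumes m: "m > 0" and jk: "j \<le> m" "k \<le> m" and pq: "p < wave_dim m j" "q < wave_dim m k"
  shows "(\<Sum>i<2 * m. wave m j p i * wave m k q i) =
    (if j = k \<and> p = q then real (2 * m) / real (wave_dim m j) else 0)"
proof -
  define n where "n = 2 * m"
  have n: "n > 0" using m by (simp add: n_def)
  define S where "S l = (\<Sum>i<n. cos (real (2 * i + 1) * (of_int l * (pi / real n))))" for l :: int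
  define T where "T l = (\<Sum>i<n. sin (real (2 * i + 1) * (of_int l * (pi / real n))))" for l :: int
  have T: "T l = 0" for l using sum_cos_midpoints(2)[OF n] by (simp add: T_def)
  have S: "S l = 0" if "\<not> int n dvd l" for l using sum_cos_midpoints(1)[OF n that] by (simp add: S_def)
  have S0: "S 0 = real n" by (simp add: S_def)
  have "cos (real (2 * i + 1) * (of_int (int n) * (pi / real n))) = -1" for i
  proof -
    have "real (2 * i + 1) * (of_int (int n) * (pi / real n)) = 2 * real i * pi + pi"
      using n by (simp add: algebra_simps)
    then show ?thesis by (simp only: cos_add) simp
  qed
  then have Sn: "S (int n) = - real n"
    unfolding S_def by (simp only: sum_constant) simp
  have ndvd: "\<not> int n dvd l" if "l \<noteq> 0" "\<bar>l\<bar> < int n" for l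
    using that by (metis dvd_abs_iff zdvd_not_zless zero_less_abs_iff)
  have add: "real j * angle n i + real k * angle n i = real (2 * i + 1) * (of_int (int j + int k) * (pi / real n))"
    and diff: "real j * angle n i - real k * angle n i = real (2 * i + 1) * (of_int (int j - int k) * (pi / real n))" for i
    by (simp_all add: angle_def algebra_simps add_divide_distrib diff_divide_distrib)
  have CC: "(\<Sum>i<n. cos (real j * angle n i) * cos (real k * angle n i)) = (S (int j - int k) + S (int j + int k)) / 2"
    unfolding cos_times_cos add diff S_def by (simp only: sum.distrib flip: sum_divide_distrib)
  have SS: "(\<Sum>i<n. sin (real j * angle n i) * sin (real k * angle n i)) = (S (int j - int k) - S (int j + int k)) / 2"
    unfolding sin_times_sin add diff S_def by (simp only: sum_subtractf flip: sum_divide_distrib)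
  have SC: "(\<Sum>i<n. sin (real j * angle n i) * cos (real k * angle n i)) = (T (int j + int k) + T (int j - int k)) / 2"
    unfolding sin_times_cos add diff T_def by (simp only: sum.distrib flip: sum_divide_distrib)
  have CS: "(\<Sum>i<n. cos (real j * angle n i) * sin (real k * angle n i)) = (T (int j + int k) - T (int j - int k)) / 2"
    unfolding cos_times_sin add diff T_def by (simp only: sum_subtractf flip: sum_divide_distrib)
  have off: "S (int j - int k) = 0" "S (int j + int k) = 0" if "j \<noteq> k"
  proof -
    have "int j - int k \<noteq> 0" "\<bar>int j - int k\<bar> < int n" "int j + int k \<noteq> 0" "\<bar>int j + int k\<bar> < int n"
      using that jk m by (auto simp: n_def)
    then show "S (int j - int k) = 0" "S (int j + int k) = 0" using S ndvd by blast+
  qed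
  have diag: "S (int j + int k) = 0" if "j = k" "0 < j" "j < m"
  proof -
    have "int j + int k \<noteq> 0" "\<bar>int j + int k\<bar> < int n" using that by (auto simp: n_def)
    then show ?thesis using S ndvd by blast
  qed
  consider (cos_cos) "p = 0" "j < m" "q = 0" "k < m" | (cos_sin) "p = 0" "j < m" "\<not> (q = 0 \<and> k < m)"
    | (sin_cos) "\<not> (p = 0 \<and> j < m)" "q = 0" "k < m"
    | (sin_sin) "\<not> (p = 0 \<and> j < m)" "\<not> (q = 0 \<and> k < m)" by blast
  then show ?thesis
  proof cases
    case cos_cos
    then have "(\<Sum>i<n. wave m j p i * wave m k q i) = (S (int j - int k) + S (int j + int k)) / 2"
      unfolding CC[symmetric] by (simp add: wave_def n_def)
    moreover have "\<dots> = (if j = k then real n / real (wave_dim m j) else 0)"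
      using cos_cos off diag S0 by (cases "j = 0") (auto simp: wave_dim_def)
    ultimately show ?thesis using cos_cos by (simp add: n_def)
  next
    case cos_sin
    then have "(\<Sum>i<n. wave m j p i * wave m k q i) = 0"
      using CS unfolding T by (auto simp: wave_def n_def)
    moreover have "\<not> (j = k \<and> p = q)" using cos_sin by auto
    ultimately show ?thesis by (auto simp: n_def)
  next
    case sin_cos
    then have "(\<Sum>i<n. wave m j p i * wave m k q i) = 0"
      using SC unfolding T by (auto simp: wave_def n_def)
    moreover have "\<not> (j = k \<and> p = q)" using sin_cos by auto
    ultimately show ?thesis by (auto simp: n_def)
  next
    case sin_sin
    then have "(\<Sum>i<n. wave m j p i * wave m k q i) = (S (int j - int k) - S (int j + int k)) / 2"
      unfolding SS[symmetric] by (auto simp: wave_def n_def)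
    moreover have pos: "0 < j" "0 < k" using sin_sin pq m by (auto simp: wave_dim_def split: if_splits)
    moreover have "(S (int j - int k) - S (int j + int k)) / 2 = (if j = k then real n / real (wave_dim m j) else 0)"
    proof (cases "j = k")
      case True
      show ?thesis
      proof (cases "j = m")
        case True
        have "int j + int k = int n" using True \<open>j = k\<close> by (simp add: n_def)
        then show ?thesis using True \<open>j = k\<close> S0 Sn by (simp add: wave_dim_def)
      next
        case False
        then show ?thesis using \<open>j = k\<close> S0 diag pos jk by (simp add: wave_dim_def)
      qed
    qed (use off in simp)
    moreover have "j = k \<Longrightarrow> p = q"
      using sin_sin pq jk by (auto simp: wave_dim_def split: if_splits)
    ultimately show ?thesis by (auto simp: n_def)
  qed
qed

text \<open>The addition theorem for the cosine. At \<open>j = 0\<close> and \<open>j = m\<close> the missing wave vanishes at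
  all sample points.\<close>

lemma wave_projection:
  assumes m: "m > 0" and j: "j \<le> m"
  shows "(\<Sum>q<wave_dim m j. wave m j q a * wave m j q b) =
    cos (2 * pi * real j * (real a - real b) / real (2 * m))"
proof -
  have diff: "real j * angle (2 * m) a - real j * angle (2 * m) b = 2 * pi * real j * (real a - real b) / real (2 * m)"
    using m by (simp add: angle_def field_simps)
  have C: "cos (2 * pi * real j * (real a - real b) / real (2 * m)) =
      cos (real j * angle (2 * m) a) * cos (real j * angle (2 * m) b) +
      sin (real j * angle (2 * m) a) * sin (real j * angle (2 * m) b)"
    unfolding diff[symmetric] by (rule cos_diff)
  consider "j = 0" | "j = m" "j \<noteq> 0" | "0 < j" "j < m" using j by linarith
  then show ?thesis
  proof cases
    case 1
    then show ?thesis using m by (simp add: wave_dim_def wave_def)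
  next
    case 2
    have "real j * angle (2 * m) i = real i * pi + pi / 2" for i
      using 2 m by (simp add: angle_def field_simps)
    then have "cos (real j * angle (2 * m) i) = 0" for i
      by (simp only: cos_add sin_npi cos_pi_half)
    then show ?thesis unfolding C using 2 by (simp add: wave_dim_def wave_def)
  next
    case 3
    then show ?thesis unfolding C by (simp add: wave_dim_def wave_def numeral_2_eq_2)
  qed
qed

text \<open>Writing \<open>x\<close> for \<open>2 \<pi> (a - b) / (2 m)\<close>, this is the Dirichlet kernel
  \<open>1 + 2 cos x + \<dots> + 2 cos ((m - 1) x) + cos (m x)\<close>, evaluated at a point where
  \<open>sin (m x)\<close> vanishes.\<close>

lemma wave_complete:
  assumes m: "m > 0" and ab: "a < 2 * m" "b < 2 * m"
  shows "(\<Sum>j\<in>{0..m}. real (wave_dim m j) / real (2 * m) * cos (2 * pi * real j * (real a - real b) / real (2 * m))) =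
    (if a = b then 1 else 0)"
proof -
  define n where "n = 2 * m"
  define x where "x = 2 * pi * (real a - real b) / real n"
  have n: "real n > 0" "real n = 2 * real m" using m by (auto simp: n_def)
  have "(\<Sum>j\<in>{0..m}. real (wave_dim m j) / real n * cos (2 * pi * real j * (real a - real b) / real n)) =
      (\<Sum>j\<in>{0..m}. real (wave_dim m j) / real n * cos (real j * x))"
    by (intro sum.cong) (simp_all add: x_def mult_ac)
  also have "\<dots> = 1 / real n + (1 / real n * cos (real m * x) +
      (\<Sum>j\<in>{1..m - 1}. real (wave_dim m j) / real n * cos (real j * x)))"
  proof -
    have "{0..m} = insert 0 (insert m {1..m - 1})" using m by auto
    then show ?thesis using m by (simp add: wave_dim_def)
  qed
  also have "(\<Sum>j\<in>{1..m - 1}. real (wave_dim m j) / real n * cos (real j * x)) =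
      2 / real n * (\<Sum>j\<in>{1..m - 1}. cos (real j * x))"
    unfolding sum_distrib_left by (intro sum.cong) (auto simp: wave_dim_def)
  finally have total: "(\<Sum>j\<in>{0..m}. real (wave_dim m j) / real n * cos (2 * pi * real j * (real a - real b) / real n)) =
      (1 + cos (real m * x) + 2 * (\<Sum>j\<in>{1..m - 1}. cos (real j * x))) / real n"
    by (simp add: add_divide_distrib)
  have mx: "real m * x = pi * (real a - real b)" using m by (simp add: x_def n)
  have "(1 + cos (real m * x) + 2 * (\<Sum>j\<in>{1..m - 1}. cos (real j * x))) / real n = (if a = b then 1 else 0)"
  proof (cases "a = b")
    case True
    then show ?thesis using m by (simp add: x_def n of_nat_diff)
  next
    case False
    have "\<not> int n dvd (int a - int b)"
    proof
      assume "int n dvd (int a - int b)"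
      then have "int n dvd \<bar>int a - int b\<bar>" by simp
      moreover have "\<bar>int a - int b\<bar> < int n" "0 < \<bar>int a - int b\<bar>"
        using ab False by (auto simp: n_def)
      ultimately show False using zdvd_not_zless by blast
    qed
    then have nz: "sin (x / 2) \<noteq> 0"
      using sin_frac_pi_nonzero[of n "int a - int b"] n(1) by (simp add: x_def mult.commute)
    have "sin (pi * (real a - real b)) = sin (of_int (int a - int b) * pi)" by (simp add: mult.commute)
    also have "\<dots> = 0" unfolding sin_zero_iff_int2 by blast
    finally have s0: "sin (pi * (real a - real b)) = 0" .
    have "(real (m - 1) + 1 / 2) * x = pi * (real a - real b) - x / 2"
      using m mx by (simp add: algebra_simps)
    then have "sin ((real (m - 1) + 1 / 2) * x) = - cos (real m * x) * sin (x / 2)"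
      using s0 by (simp add: sin_diff mx)
    then have "2 * sin (x / 2) * (\<Sum>j\<in>{1..m - 1}. cos (real j * x)) =
        - cos (real m * x) * sin (x / 2) - sin (x / 2)"
      using sum_cos_multiples[of x "m - 1"] by simp
    then have "sin (x / 2) * (1 + cos (real m * x) + 2 * (\<Sum>j\<in>{1..m - 1}. cos (real j * x))) = 0"
      by (simp add: algebra_simps)
    then show ?thesis using nz False by simp
  qed
  then show ?thesis using total by (simp add: n_def)
qed

section \<open>The isotypic blocks of the dihedral algebra\<close>

definition rotation_mat :: "real \<Rightarrow> complex mat" where
  "rotation_mat x = mat_of_rows_list 2 [[of_real (cos x), - of_real (sin x)], [of_real (sin x), of_real (cos x)]]"

lemma rotation_mat_dims [simp]: "dim_row (rotation_mat x) = 2" "dim_col (rotation_mat x) = 2"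
  by (simp_all add: rotation_mat_def mat_of_rows_list_def)

lemma rotation_mat_index [simp]:
  "rotation_mat x $$ (0, 0) = of_real (cos x)" "rotation_mat x $$ (0, Suc 0) = - of_real (sin x)"
  "rotation_mat x $$ (Suc 0, 0) = of_real (sin x)" "rotation_mat x $$ (Suc 0, Suc 0) = of_real (cos x)"
  by (simp_all add: rotation_mat_def mat_of_rows_list_def)

lemma plane_reflection_dims [simp]: "dim_row plane_reflection = 2" "dim_col plane_reflection = 2"
  by (simp_all add: plane_reflection_def mat_of_rows_list_def)

lemma plane_reflection_index [simp]:
  "plane_reflection $$ (0, 0) = 1" "plane_reflection $$ (0, Suc 0) = 0"
  "plane_reflection $$ (Suc 0, 0) = 0" "plane_reflection $$ (Suc 0, Suc 0) = - 1"
  by (simp_all add: plane_reflection_def mat_of_rows_list_def)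

lemma plane_rotation_eq: "plane_rotation n = rotation_mat (2 * pi / real n)"
  by (simp add: plane_rotation_def rotation_mat_def)

lemma mult_2_index:
  fixes A X :: "complex mat"
  assumes "dim_col A = 2" "dim_row X = 2" "a < dim_row A" "b < dim_col X"
  shows "(A * X) $$ (a, b) = A $$ (a, 0) * X $$ (0, b) + A $$ (a, Suc 0) * X $$ (Suc 0, b)"
  using assms by (simp add: scalar_prod_def numeral_2_eq_2)

lemma rotation_mat_mult: "rotation_mat x * rotation_mat y = rotation_mat (x + y)"
  by (intro eq_matI) (auto simp: mult_2_index less_2_cases_iff cos_add sin_add simp del: index_mult_mat(1))

lemma rotation_mat_pow: "rotation_mat x ^\<^sub>m k = rotation_mat (real k * x)"
proof (induction k)
  case 0
  show ?case by (intro eq_matI) (auto simp: less_2_cases_iff)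
next
  case (Suc k)
  then show ?case by (simp add: rotation_mat_mult algebra_simps)
qed

lemma rotation_mat_cong_mod:
  assumes "k mod n = l mod n"
  shows "rotation_mat (real k * (2 * pi / real n)) = rotation_mat (real l * (2 * pi / real n))"
proof -
  have "rotation_mat (real k * (2 * pi / real n)) = rotation_mat (real (k mod n) * (2 * pi / real n))" for k
  proof (cases "n = 0")
    case False
    have "real k = real (k div n) * real n + real (k mod n)"
      by (simp flip: of_nat_mult of_nat_add)
    then have "real k * (2 * pi / real n) = 2 * real (k div n) * pi + real (k mod n) * (2 * pi / real n)"
      using False by (simp add: field_simps)
    then show ?thesis
      by (simp only: rotation_mat_def cos_add sin_add cos_2npi sin_2npi) simp
  qed simp
  then show ?thesis using assms by metis
qed

text \<open>\<open>wave_mat\<close> and \<open>wave_dual\<close> are the intertwiners for frequency \<open>j\<close>; the dual is the transpose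
  divided by the common squared norm \<open>2 m / wave_dim m j\<close> of the columns.\<close>

definition wave_mat :: "nat \<Rightarrow> nat \<Rightarrow> complex mat" where
  "wave_mat m j = mat (2 * m) (wave_dim m j) (\<lambda>(i, q). of_real (wave m j q i))"

definition wave_dual :: "nat \<Rightarrow> nat \<Rightarrow> complex mat" where
  "wave_dual m j = mat (wave_dim m j) (2 * m)
     (\<lambda>(q, i). of_real (real (wave_dim m j) / real (2 * m) * wave m j q i))"

definition block_rep :: "nat \<Rightarrow> nat \<Rightarrow> (nat \<Rightarrow> nat) \<Rightarrow> complex mat" where
  "block_rep m j = (if j = 0 then char_rep chi_triv else if j = m then char_rep (chi_prime m)
     else pi2_pow (2 * m) j)"

lemma wave_dims [simp]:
  "dim_row (wave_mat m j) = 2 * m" "dim_col (wave_mat m j) = wave_dim m j"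
  "dim_row (wave_dual m j) = wave_dim m j" "dim_col (wave_dual m j) = 2 * m"
  by (simp_all add: wave_mat_def wave_dual_def)

lemma wave_dual_times_wave_mat:
  assumes "m > 0" "j \<le> m" "k \<le> m"
  shows "wave_dual m j * wave_mat m k = (if j = k then 1\<^sub>m (wave_dim m j) else 0\<^sub>m (wave_dim m j) (wave_dim m k))"
proof (rule eq_matI)
  let ?N = "if j = k then 1\<^sub>m (wave_dim m j) else 0\<^sub>m (wave_dim m j) (wave_dim m k) :: complex mat"
  show dims: "dim_row (wave_dual m j * wave_mat m k) = dim_row ?N"
    "dim_col (wave_dual m j * wave_mat m k) = dim_col ?N" by auto
  fix p q assume "p < dim_row ?N" "q < dim_col ?N"
  then have pq: "p < wave_dim m j" "q < wave_dim m k" by (auto split: if_splits)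
  have "(wave_dual m j * wave_mat m k) $$ (p, q) =
      (\<Sum>i<2 * m. of_real (real (wave_dim m j) / real (2 * m) * wave m j p i) * of_real (wave m k q i))"
    using pq by (simp add: scalar_prod_def wave_dual_def wave_mat_def atLeast0LessThan)
  also have "\<dots> = of_real (real (wave_dim m j) / real (2 * m) * (\<Sum>i<2 * m. wave m j p i * wave m k q i))"
    by (simp add: sum_distrib_left mult.assoc)
  also have "\<dots> = ?N $$ (p, q)"
    unfolding wave_gram[OF assms pq] using pq assms by (auto simp: wave_dim_def)
  finally show "(wave_dual m j * wave_mat m k) $$ (p, q) = ?N $$ (p, q)" .
qed

lemma wave_mat_times_wave_dual:
  assumes "m > 0" "j \<le> m"
  shows "wave_mat m j * wave_dual m j = mat (2 * m) (2 * m) (\<lambda>(a, b).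
    of_real (real (wave_dim m j) / real (2 * m) * cos (2 * pi * real j * (real a - real b) / real (2 * m))))"
proof (rule eq_matI)
  fix a b
  let ?N = "mat (2 * m) (2 * m) (\<lambda>(a, b). complex_of_real
    (real (wave_dim m j) / real (2 * m) * cos (2 * pi * real j * (real a - real b) / real (2 * m))))"
  assume "a < dim_row ?N" "b < dim_col ?N"
  then have ab: "a < 2 * m" "b < 2 * m" by auto
  have "(wave_mat m j * wave_dual m j) $$ (a, b) =
      (\<Sum>q<wave_dim m j. of_real (wave m j q a) * of_real (real (wave_dim m j) / real (2 * m) * wave m j q b))"
    using ab by (simp add: scalar_prod_def wave_dual_def wave_mat_def atLeast0LessThan)
  also have "\<dots> = of_real (real (wave_dim m j) / real (2 * m) * (\<Sum>q<wave_dim m j. wave m j q a * wave m j q b))"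
    by (simp add: sum_distrib_left mult_ac)
  finally show "(wave_mat m j * wave_dual m j) $$ (a, b) = ?N $$ (a, b)"
    unfolding wave_projection[OF assms] using ab by simp
qed auto

text \<open>The exponent that \<open>dih_exp\<close> returns matters only modulo \<open>n\<close>, because rotation by \<open>2 \<pi>\<close> is the
  identity.\<close>

lemma pi2_pow_values:
  assumes n: "n \<ge> 3"
  shows "pi2_pow n j (rot_perm n ^^ k) = rotation_mat (real (j * k) * (2 * pi / real n))"
    and "pi2_pow n j (refl_perm n \<circ> rot_perm n ^^ k) = plane_reflection * rotation_mat (real (j * k) * (2 * pi / real n))"
proof -
  note rots = is_rotation_values[OF n]
  have pi2: "pi2 n (rot_perm n ^^ k) = rotation_mat (real k * (2 * pi / real n))"
    "pi2 n (refl_perm n \<circ> rot_perm n ^^ k) = plane_reflection * rotation_mat (real k * (2 * pi / real n))" for k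
    using rotation_mat_cong_mod[OF dih_exp_mod(1)[OF n, of k]] rotation_mat_cong_mod[OF dih_exp_mod(2)[OF n, of k]]
    by (simp_all add: pi2_def Let_def rots plane_rotation_eq rotation_mat_pow del: comp_apply)
  have mod: "(j * dih_exp n (rot_perm n ^^ k)) mod n = (j * k) mod n"
    "(j * dih_exp n (refl_perm n \<circ> rot_perm n ^^ k)) mod n = (j * k) mod n"
    using dih_exp_mod[OF n, of k] by (metis mod_mult_right_eq)+
  show "pi2_pow n j (rot_perm n ^^ k) = rotation_mat (real (j * k) * (2 * pi / real n))"
    unfolding pi2_pow_def comp_apply[of "pi2 n"] dih_phi_def Let_def
    using rots(1) rotation_mat_cong_mod[OF mod(1)] by (simp only: if_True pi2)
  show "pi2_pow n j (refl_perm n \<circ> rot_perm n ^^ k) = plane_reflection * rotation_mat (real (j * k) * (2 * pi / real n))"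
    unfolding pi2_pow_def comp_apply[of "pi2 n"] dih_phi_def Let_def
    using rots(2) rotation_mat_cong_mod[OF mod(2)] by (simp only: if_False pi2)
qed

text \<open>\<open>rot_mat\<close> and \<open>refl_mat\<close> are the values of \<open>block_rep m j\<close> on \<open>R^k\<close> and on \<open>C\<close>.\<close>

definition rot_mat :: "nat \<Rightarrow> nat \<Rightarrow> nat \<Rightarrow> complex mat" where
  "rot_mat m j k = (if j = 0 then 1\<^sub>m 1 else if j = m then (-1) ^ k \<cdot>\<^sub>m 1\<^sub>m 1
     else rotation_mat (real (j * k) * (2 * pi / real (2 * m))))"

definition refl_mat :: "nat \<Rightarrow> nat \<Rightarrow> complex mat" where
  "refl_mat m j = (if j = 0 then 1\<^sub>m 1 else if j = m then (-1) \<cdot>\<^sub>m 1\<^sub>m 1 else plane_reflection)"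

lemma rot_refl_mat_dims [simp]:
  "dim_row (rot_mat m j k) = wave_dim m j" "dim_col (rot_mat m j k) = wave_dim m j"
  "dim_row (refl_mat m j) = wave_dim m j" "dim_col (refl_mat m j) = wave_dim m j"
  by (auto simp: rot_mat_def refl_mat_def wave_dim_def)

lemma block_rep_values:
  assumes m: "m \<ge> 2"
  shows "block_rep m j (rot_perm (2 * m) ^^ k) = rot_mat m j k"
    and "block_rep m j (refl_perm (2 * m) \<circ> rot_perm (2 * m) ^^ k) = refl_mat m j * rot_mat m j k"
proof -
  have n: "2 * m \<ge> 3" using m by simp
  show "block_rep m j (rot_perm (2 * m) ^^ k) = rot_mat m j k"
    unfolding block_rep_def rot_mat_def
    by (auto simp: pi2_pow_values[OF n] char_rep_def chi_triv_def chi_prime_values[OF m])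
  show "block_rep m j (refl_perm (2 * m) \<circ> rot_perm (2 * m) ^^ k) = refl_mat m j * rot_mat m j k"
  proof -
    consider "j = 0" | "j = m" "j \<noteq> 0" | "j \<noteq> 0" "j \<noteq> m" by blast
    then show ?thesis
    proof cases
      case 1
      then show ?thesis
        by (intro eq_matI) (auto simp: block_rep_def rot_mat_def refl_mat_def char_rep_def chi_triv_def)
    next
      case 2
      have "block_rep m j (refl_perm (2 * m) \<circ> rot_perm (2 * m) ^^ k) = mat 1 1 (\<lambda>_. - ((-1) ^ k))"
      proof -
        have "block_rep m j = char_rep (chi_prime m)" using 2 by (simp add: block_rep_def)
        then show ?thesis by (simp only: char_rep_def chi_prime_values(2)[OF m])
      qed
      also have "\<dots> = refl_mat m j * rot_mat m j k"
        using 2 by (intro eq_matI) (auto simp: rot_mat_def refl_mat_def scalar_prod_def)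
      finally show ?thesis .
    next
      case 3
      then show ?thesis
        by (simp only: block_rep_def rot_mat_def refl_mat_def pi2_pow_values(2)[OF n] if_False)
    qed
  qed
qed

text \<open>Rotating the index by \<open>k\<close> shifts the angle by \<open>2 \<pi> k / n\<close>, up to full turns.\<close>

lemma rot_intertwines:
  assumes m: "m > 0" and j: "j \<le> m"
  shows "perm_mat (2 * m) (rot_perm (2 * m) ^^ k) * wave_mat m j = wave_mat m j * rot_mat m j k"
proof (rule perm_mat_mult_eq[OF rot_pow_permutes])
  show "wave_mat m j \<in> carrier_mat (2 * m) (wave_dim m j)"
    "wave_mat m j * rot_mat m j k \<in> carrier_mat (2 * m) (wave_dim m j)" by auto
  fix i q assume i: "i < 2 * m" and q: "q < wave_dim m j"
  define n where "n = 2 * m"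
  \<comment> \<open>\<open>t\<close> counts the full turns made when \<open>i + k\<close> wraps around.\<close>
  define b where "b = (i + k) mod n"
  define t where "t = (i + k) div n"
  have n: "n > 0" using m by (simp add: n_def)
  have b: "b < n" using n by (simp add: b_def)
  have bt: "i + k = t * n + b" by (simp add: b_def t_def)
  then have rb: "real b = real i + real k - real t * real n"
    by (metis add_diff_cancel_left' of_nat_add of_nat_mult)
  have angle: "real j * angle n b = real j * angle n i + real (j * k) * (2 * pi / real n) - 2 * real (j * t) * pi"
    using n by (simp add: angle_def rb field_simps)
  have goal: "(wave_mat m j * rot_mat m j k) $$ (b, q) = wave_mat m j $$ (i, q)"
  proof -
    consider "j = 0" | "j = m" "j \<noteq> 0" | "0 < j" "j < m" using j by linarith
    then show ?thesis
    proof cases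
      case 1
      then show ?thesis using i b q m
        by (simp add: rot_mat_def wave_mat_def wave_def n_def wave_dim_def scalar_prod_def)
    next
      case 2
      have "real j * angle n c = real c * pi + pi / 2" for c
        using 2 m by (simp add: angle_def n_def field_simps)
      then have s: "sin (real j * angle n c) = (-1) ^ c" for c
        by (simp add: sin_add)
      have "even (b + k) \<longleftrightarrow> even i" using bt by (metis even_add even_mult_iff n_def dvd_triv_left)
      then have "(-1 :: complex) ^ b * (-1) ^ k = (-1) ^ i" by (metis power_add neg_one_even_power neg_one_odd_power)
      then show ?thesis using i b q m 2 s
        by (simp add: rot_mat_def wave_mat_def wave_def wave_dim_def scalar_prod_def n_def)
    next
      case 3
      let ?\<phi> = "real (j * k) * (2 * pi / real n)"
      have shift: "real j * angle n b - ?\<phi> = real j * angle n i - 2 * real (j * t) * pi"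
        using angle by simp
      have c: "cos (real j * angle n b - ?\<phi>) = cos (real j * angle n i)"
        and s: "sin (real j * angle n b - ?\<phi>) = sin (real j * angle n i)"
        unfolding shift by (simp_all only: cos_diff sin_diff cos_2npi sin_2npi)
      have "of_real (cos (real j * angle n b)) * of_real (cos ?\<phi>) +
          of_real (sin (real j * angle n b)) * of_real (sin ?\<phi>) = complex_of_real (cos (real j * angle n i))"
        and "of_real (sin (real j * angle n b)) * of_real (cos ?\<phi>) -
          of_real (cos (real j * angle n b)) * of_real (sin ?\<phi>) = complex_of_real (sin (real j * angle n i))"
        unfolding c[symmetric] s[symmetric] cos_diff sin_diff by (simp_all only: of_real_mult of_real_add of_real_diff)
      moreover have "q = 0 \<or> q = Suc 0" using q 3 by (auto simp: wave_dim_def)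
      moreover have "rot_mat m j k = rotation_mat ?\<phi>" using 3 by (simp add: rot_mat_def n_def)
      ultimately show ?thesis
        using 3 i b
        by (auto simp: mult_2_index wave_dim_def n_def wave_mat_def wave_def algebra_simps
            simp del: index_mult_mat(1) of_nat_mult)
    qed
  qed
  have "(rot_perm (2 * m) ^^ k) (Suc i) - 1 = b"
    using rot_pow_Suc_apply[OF i] by (simp add: b_def n_def)
  then show "(wave_mat m j * rot_mat m j k) $$ ((rot_perm (2 * m) ^^ k) (Suc i) - 1, q) = wave_mat m j $$ (i, q)"
    using goal by simp
qed

lemma refl_intertwines:
  assumes m: "m > 0" and j: "j \<le> m"
  shows "perm_mat (2 * m) (refl_perm (2 * m)) * wave_mat m j = wave_mat m j * refl_mat m j"
proof (rule perm_mat_mult_eq[OF refl_perm_permutes])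
  show "wave_mat m j \<in> carrier_mat (2 * m) (wave_dim m j)"
    "wave_mat m j * refl_mat m j \<in> carrier_mat (2 * m) (wave_dim m j)" by auto
  fix i q assume i: "i < 2 * m" and q: "q < wave_dim m j"
  define b where "b = 2 * m - Suc i"
  have b: "b < 2 * m" using m by (simp add: b_def)
  have rb: "real b = 2 * real m - real i - 1" using i by (simp add: b_def)
  have angle: "real j * angle (2 * m) b = 2 * real j * pi - real j * angle (2 * m) i"
    using m by (simp add: angle_def rb field_simps)
  have c: "cos (real j * angle (2 * m) b) = cos (real j * angle (2 * m) i)"
    and s: "sin (real j * angle (2 * m) b) = - sin (real j * angle (2 * m) i)"
    unfolding angle by (simp_all only: cos_diff sin_diff cos_2npi sin_2npi)
  have goal: "(wave_mat m j * refl_mat m j) $$ (b, q) = wave_mat m j $$ (i, q)"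
  proof -
    consider "j = 0" | "j = m" "j \<noteq> 0" | "0 < j" "j < m" using j by linarith
    then show ?thesis
    proof cases
      case 1
      then show ?thesis using i b q m
        by (simp add: refl_mat_def wave_mat_def wave_def wave_dim_def scalar_prod_def)
    next
      case 2
      then show ?thesis using i b q s
        by (simp add: refl_mat_def wave_mat_def wave_def wave_dim_def scalar_prod_def)
    next
      case 3
      have "q = 0 \<or> q = Suc 0" using q 3 by (auto simp: wave_dim_def)
      then show ?thesis
        using 3 i b c s
        by (auto simp: mult_2_index refl_mat_def wave_dim_def wave_mat_def wave_def simp del: index_mult_mat(1))
    qed
  qed
  have "refl_perm (2 * m) (Suc i) - 1 = b" using i by (simp add: refl_perm_def b_def)
  then show "(wave_mat m j * refl_mat m j) $$ (refl_perm (2 * m) (Suc i) - 1, q) = wave_mat m j $$ (i, q)"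
    using goal by simp
qed

lemma dihedral_intertwines:
  assumes m: "m \<ge> 2" and j: "j \<le> m" and g: "g \<in> carrier (dihedral (2 * m))"
  shows "perm_mat (2 * m) g * wave_mat m j = wave_mat m j * block_rep m j g"
proof -
  have m0: "m > 0" using m by simp
  from g show ?thesis
  proof (cases rule: dihedral_cases)
    case (rotation k)
    then show ?thesis using rot_intertwines[OF m0 j] by (simp only: block_rep_values[OF m])
  next
    case (reflection k)
    let ?R = "perm_mat (2 * m) (rot_perm (2 * m) ^^ k)" and ?C = "perm_mat (2 * m) (refl_perm (2 * m))"
    have "perm_mat (2 * m) g * wave_mat m j = ?C * (?R * wave_mat m j)"
      unfolding reflection perm_mat_comp[OF refl_perm_permutes rot_pow_permutes] by (simp add: mat_assoc)
    also have "\<dots> = (?C * wave_mat m j) * rot_mat m j k"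
      unfolding rot_intertwines[OF m0 j] by (simp add: mat_assoc)
    also have "\<dots> = wave_mat m j * (refl_mat m j * rot_mat m j k)"
      unfolding refl_intertwines[OF m0 j] by (simp add: mat_assoc)
    finally show ?thesis using block_rep_values(2)[OF m] reflection by simp
  qed
qed

text \<open>Linear combinations of the powers of the rotation are the circulant matrices.\<close>

lemma sum_rot_pow_index:
  assumes "a < n" "b < n"
  shows "(\<Sum>k\<in>{0..<n}. f k * perm_mat n (rot_perm n ^^ k) $$ (a, b)) = f ((a + n - b) mod n)"
proof -
  have "(b + k) mod n = a \<longleftrightarrow> k = (a + n - b) mod n" if k: "k < n" for k
  proof -
    have 1: "(b + k) mod n = (if b + k < n then b + k else b + k - n)"
      using k assms by (auto simp: mod_if)
    have 2: "(a + n - b) mod n = (if b \<le> a then a - b else a + n - b)"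
      using assms by (auto simp: mod_if)
    show ?thesis unfolding 1 2 using assms k by auto
  qed
  then have "(\<Sum>k\<in>{0..<n}. f k * perm_mat n (rot_perm n ^^ k) $$ (a, b)) =
      (\<Sum>k\<in>{0..<n}. if k = (a + n - b) mod n then f k else 0)"
    using assms by (intro sum.cong) (auto simp: perm_mat_index rot_pow_Suc_apply)
  then show ?thesis using assms by simp
qed

lemma cos_circulant:
  assumes "b < n"
  shows "cos (2 * pi * real j * (real a - real b) / real n) =
    cos (2 * pi * real j * real ((a + n - b) mod n) / real n)"
proof -
  define r t where "r = (a + n - b) mod n" and "t = (a + n - b) div n"
  have "a + n = b + (t * n + r)" using assms by (simp add: r_def t_def)
  then have "real a + real n = real b + (real t * real n + real r)"
    by (metis of_nat_add of_nat_mult)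
  then have ra: "real a = real b + real t * real n + real r - real n" by simp
  have "2 * pi * real j * (real a - real b) / real n + 2 * real j * pi =
      2 * pi * real j * real r / real n + 2 * real (j * t) * pi"
    using assms by (simp add: ra field_simps)
  then have "cos (2 * pi * real j * (real a - real b) / real n + 2 * real j * pi) =
      cos (2 * pi * real j * real r / real n + 2 * real (j * t) * pi)" by simp
  then show ?thesis unfolding r_def[symmetric] by (simp only: cos_add cos_2npi sin_2npi)
qed

abbreviation dihedral_algebra :: "nat \<Rightarrow> complex mat set" where
  "dihedral_algebra n \<equiv> generated_algebra n (perm_mat n ` carrier (dihedral n))"

text \<open>The projections are circulant, hence combinations of rotations.\<close>

lemma wave_projection_in_algebra:
  assumes "m > 0" "j \<le> m"
  shows "wave_mat m j * wave_dual m j \<in> dihedral_algebra (2 * m)"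
proof -
  define n where "n = 2 * m"
  define c where "c k = complex_of_real (real (wave_dim m j) / real n * cos (2 * pi * real j * real k / real n))" for k
  let ?f = "\<lambda>k. c k \<cdot>\<^sub>m perm_mat n (rot_perm n ^^ k)"
  have "wave_mat m j * wave_dual m j = mat n n (\<lambda>(a, b). \<Sum>k\<in>{0..<n}. ?f k $$ (a, b))"
  proof -
    have "(\<Sum>k\<in>{0..<n}. ?f k $$ (a, b)) = complex_of_real
        (real (wave_dim m j) / real n * cos (2 * pi * real j * (real a - real b) / real n))"
      if "a < n" "b < n" for a b
    proof -
      have "(\<Sum>k\<in>{0..<n}. ?f k $$ (a, b)) = c ((a + n - b) mod n)"
        using that sum_rot_pow_index[OF that, of c] by simp
      then show ?thesis using cos_circulant[OF that(2)] by (simp only: c_def)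
    qed
    then show ?thesis
      unfolding wave_mat_times_wave_dual[OF assms] n_def[symmetric] by (intro eq_matI) auto
  qed
  also have "\<dots> \<in> dihedral_algebra n"
  proof (intro generated_algebra_sum image_subsetI)
    fix k
    show "?f k \<in> dihedral_algebra n"
      using rot_pow_in_dihedral by (intro generated_algebra.smult generated_algebra.gen imageI)
  qed auto
  finally show ?thesis by (simp add: n_def)
qed

lemma sin_wave_nonzero:
  assumes "0 < j" "j < m"
  shows "sin (real j * (2 * pi / real (2 * m))) \<noteq> 0"
proof -
  have "0 < real j * (2 * pi / real (2 * m))" "real j * (2 * pi / real (2 * m)) < pi"
    using assms by (auto simp: field_simps)
  then show ?thesis using sin_gt_zero by fastforce
qed

text \<open>On a two-dimensional block the identity, the reflection, the rotation by \<open>\<theta> = 2 \<pi> j / (2 m)\<close> and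
  their product span all \<open>2 \<times> 2\<close> matrices, because \<open>sin \<theta> \<noteq> 0\<close>; multiplying the projection by
  the permutation matrices realizes these four endomorphisms.\<close>

lemma wave_block_in_algebra:
  assumes m: "m \<ge> 2" and j: "j \<le> m" and X: "X \<in> carrier_mat (wave_dim m j) (wave_dim m j)"
  shows "wave_mat m j * X * wave_dual m j \<in> dihedral_algebra (2 * m)"
proof -
  define n where "n = 2 * m"
  have m0: "m > 0" using m by simp
  note U = wave_projection_in_algebra[OF m0 j]
  let ?B = "wave_mat m j" and ?B' = "wave_dual m j"
  consider "wave_dim m j = 1" | "0 < j" "j < m"
    by (cases "j = 0 \<or> j = m") (use le_neq_implies_less[OF j] in \<open>auto simp: wave_dim_def\<close>)
  then show ?thesis
  proof cases
    case 1
    have "X = X $$ (0, 0) \<cdot>\<^sub>m 1\<^sub>m (wave_dim m j)"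
      using X 1 by (intro eq_matI) auto
    then have "?B * X * ?B' = X $$ (0, 0) \<cdot>\<^sub>m (?B * ?B')"
      by (metis mat_distribs(3,4) index_one_mat(2,3) right_mult_one_mat' wave_dims(2,3) index_mult_mat(3))
    then show ?thesis using generated_algebra.smult[OF U] by simp
  next
    case 2
    have d: "wave_dim m j = 2" using 2 by (simp add: wave_dim_def)
    define \<theta> where "\<theta> = real j * (2 * pi / real (2 * m))"
    have s: "complex_of_real (sin \<theta>) \<noteq> 0" using sin_wave_nonzero[OF 2] by (simp add: \<theta>_def)
    have in_alg: "?B * block_rep m j g * ?B' \<in> dihedral_algebra n" if "g \<in> carrier (dihedral n)" for g
    proof -
      have "?B * block_rep m j g * ?B' = perm_mat n g * (?B * ?B')"
        using dihedral_intertwines[OF m j] that by (simp add: n_def flip: mat_assoc)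
      moreover have "perm_mat n g \<in> dihedral_algebra n" using that by (auto intro: generated_algebra.gen)
      ultimately show ?thesis using generated_algebra.mult U n_def by metis
    qed
    have R: "?B * rot_mat m j k * ?B' \<in> dihedral_algebra n"
      "?B * (refl_mat m j * rot_mat m j k) * ?B' \<in> dihedral_algebra n" for k
      using in_alg[OF rot_pow_in_dihedral] in_alg[OF refl_rot_pow_in_dihedral] n_def
      by (simp_all only: block_rep_values[OF m])
    define x y z w where "x = X $$ (0, 0)" and "y = X $$ (0, Suc 0)" and "z = X $$ (Suc 0, 0)" and "w = X $$ (Suc 0, Suc 0)"
    define co si where "co = complex_of_real (cos \<theta>)" and "si = complex_of_real (sin \<theta>)"
    \<comment> \<open>Coefficients of \<open>X\<close> in this basis: the off-diagonal entries of \<open>X\<close> determine \<open>\<gamma>\<close> and \<open>\<delta>\<close>,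
      then the diagonal ones determine \<open>\<alpha>\<close> and \<open>\<beta>\<close>.\<close>
    define \<gamma> \<delta> where "\<gamma> = (z - y) / (2 * si)" and "\<delta> = - (z + y) / (2 * si)"
    define \<alpha> \<beta> where "\<alpha> = (x + w) / 2 - \<gamma> * co" and "\<beta> = (x - w) / 2 - \<delta> * co"
    let ?Y = "\<alpha> \<cdot>\<^sub>m rot_mat m j 0 + \<beta> \<cdot>\<^sub>m (refl_mat m j * rot_mat m j 0)
      + \<gamma> \<cdot>\<^sub>m rot_mat m j 1 + \<delta> \<cdot>\<^sub>m (refl_mat m j * rot_mat m j 1)"
    have rm: "rot_mat m j 0 = rotation_mat 0" "rot_mat m j 1 = rotation_mat \<theta>" "refl_mat m j = plane_reflection"
      using 2 by (simp_all add: rot_mat_def refl_mat_def \<theta>_def)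
    have "X = ?Y"
    proof (rule eq_matI)
      fix a b assume "a < dim_row ?Y" "b < dim_col ?Y"
      then have "(a = 0 \<or> a = Suc 0) \<and> (b = 0 \<or> b = Suc 0)" by (auto simp: d less_2_cases_iff)
      then show "X $$ (a, b) = ?Y $$ (a, b)"
        using s unfolding rm
        by (auto simp: mult_2_index x_def[symmetric] y_def[symmetric] z_def[symmetric] w_def[symmetric]
            co_def[symmetric] si_def[symmetric] \<alpha>_def \<beta>_def \<gamma>_def \<delta>_def field_simps simp del: index_mult_mat(1))
    qed (use X d in auto)
    then have "?B * X * ?B' = \<alpha> \<cdot>\<^sub>m (?B * rot_mat m j 0 * ?B') + \<beta> \<cdot>\<^sub>m (?B * (refl_mat m j * rot_mat m j 0) * ?B')
      + \<gamma> \<cdot>\<^sub>m (?B * rot_mat m j 1 * ?B') + \<delta> \<cdot>\<^sub>m (?B * (refl_mat m j * rot_mat m j 1) * ?B')"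
      by (simp add: mat_distribs)
    also have "\<dots> \<in> dihedral_algebra n"
      by (intro generated_algebra.add generated_algebra.smult R)
    finally show ?thesis by (simp add: n_def)
  qed
qed

lemma dihedral_isotypic_decomposition:
  assumes m: "m \<ge> 2"
  shows "isotypic_decomposition (dihedral (2 * m)) (2 * m) (perm_mat (2 * m)) {0..m} (wave_dim m)
    (wave_mat m) (wave_dual m) (block_rep m)"
proof -
  have m0: "m > 0" using m by simp
  interpret group "dihedral (2 * m)" by (rule group_dihedral)
  show ?thesis
  proof
    show "representation (dihedral (2 * m)) (2 * m) (perm_mat (2 * m))" by (rule representation_perm_mat)
    show "block_rep m j g \<in> carrier_mat (wave_dim m j) (wave_dim m j)"
      if "g \<in> carrier (dihedral (2 * m))" for j g
      using that by (cases rule: dihedral_cases) (auto simp only: block_rep_values[OF m] intro!: carrier_matI, auto)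
    show "(\<Sum>j\<in>{0..m}. (wave_mat m j * wave_dual m j) $$ (a, b)) = (if a = b then 1 else 0)"
      if ab: "a < 2 * m" "b < 2 * m" for a b
    proof -
      have "(\<Sum>j\<in>{0..m}. (wave_mat m j * wave_dual m j) $$ (a, b)) =
          complex_of_real (\<Sum>j\<in>{0..m}. real (wave_dim m j) / real (2 * m) * cos (2 * pi * real j * (real a - real b) / real (2 * m)))"
        unfolding of_real_sum by (intro sum.cong) (use ab in \<open>simp_all add: wave_mat_times_wave_dual[OF m0] del: index_mult_mat(1)\<close>)
      then show ?thesis unfolding wave_complete[OF m0 ab] by simp
    qed
  qed (use m m0 in \<open>auto simp: wave_dim_def wave_dual_times_wave_mat dihedral_intertwines intro!: wave_block_in_algebra\<close>)
qed

lemma U_triv_eq: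
  assumes "m > 0"
  shows "U_triv (2 * m) = wave_mat m 0 * wave_dual m 0"
  unfolding wave_mat_times_wave_dual[OF assms le0]
  by (intro eq_matI) (auto simp: U_triv_def all_ones_def mat_from1_def wave_dim_def)

lemma U_chi'_eq:
  assumes "m > 0"
  shows "U_chi' (2 * m) = wave_mat m m * wave_dual m m"
  unfolding wave_mat_times_wave_dual[OF assms le_refl]
proof (intro eq_matI, goal_cases)
  case (1 a b)
  have "2 * pi * real m * (real a - real b) / real (2 * m) = real a * pi - real b * pi"
    using assms by (simp add: field_simps)
  then have "cos (2 * pi * real m * (real a - real b) / real (2 * m)) = (-1) ^ (a + b)"
    by (simp add: cos_diff power_add)
  then show ?case using 1 by (simp add: U_chi'_def mat_from1_def wave_dim_def)
qed (simp_all add: U_chi'_def mat_from1_def)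

lemma U_pi2_entries:
  "U_pi2 n j = mat n n (\<lambda>(a, b). 2 / of_nat n *
    of_real (cos (2 * pi * real j * (real a - real b) / real n)))"
proof -
  interpret M: ring "cmat_ring n" by (rule ring_mat)
  have M: "(cmat_ring n)\<lparr>carrier := carrier_mat n n\<rparr> = cmat_ring n" by (simp add: ring_mat_def)
  define c where "c k = complex_of_real (cos (2 * pi * real j * real k / real n))" for k
  let ?f = "\<lambda>k. c k \<cdot>\<^sub>m perm_mat n (rot_perm n ^^ k)"
  have "U_pi2 n j = (2 / of_nat n) \<cdot>\<^sub>m finsum (cmat_ring n) ?f {0..<n}"
    by (simp add: U_pi2_def c_def mult_ac)
  also have "finsum (cmat_ring n) ?f {0..<n} = mat n n (\<lambda>(a, b). \<Sum>k\<in>{0..<n}. ?f k $$ (a, b))"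
    using index_finsum_mat[where n = n and H = "carrier_mat n n" and K = "{0..<n}" and f = ?f]
      M.abelian_monoid_axioms unfolding M by (auto simp: image_subset_iff)
  also have "\<dots> = mat n n (\<lambda>(a, b). of_real (cos (2 * pi * real j * (real a - real b) / real n)))"
  proof -
    have "(\<Sum>k\<in>{0..<n}. ?f k $$ (a, b)) = of_real (cos (2 * pi * real j * (real a - real b) / real n))"
      if "a < n" "b < n" for a b
    proof -
      have "(\<Sum>k\<in>{0..<n}. ?f k $$ (a, b)) = c ((a + n - b) mod n)"
        using that sum_rot_pow_index[OF that, of c] by simp
      then show ?thesis using cos_circulant[OF that(2)] by (simp only: c_def)
    qed
    then show ?thesis by (intro eq_matI) auto
  qed
  finally show ?thesis by (auto intro!: eq_matI)
qed

lemma U_pi2_eq: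
  assumes "0 < j" "j < m"
  shows "U_pi2 (2 * m) j = wave_mat m j * wave_dual m j"
proof -
  have m: "m > 0" and j: "j \<le> m" using assms by auto
  show ?thesis
    unfolding wave_mat_times_wave_dual[OF m j]
    using U_pi2_entries[of "2 * m" j] assms by (intro eq_matI) (auto simp: wave_dim_def)
qed

theorem theorem4:
  fixes m n :: nat
  assumes "m \<ge> 2" and "n = 2 * m"
  shows "complete_orthogonal_idempotents (MM n)
           ({U_triv n, U_chi' n} \<union> U_pi2 n ` {1..m - 1}) \<and>
         card ({U_triv n, U_chi' n} \<union> U_pi2 n ` {1..m - 1}) = m + 1 \<and>
         corresponds_to n (U_triv n) 1 (char_rep chi_triv) \<and>
         corresponds_to n (U_chi' n) 1 (char_rep (chi_prime m)) \<and>
         (\<forall>j\<in>{1..m - 1}. corresponds_to n (U_pi2 n j) 2 (pi2_pow n j)) \<and>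
         (\<forall>j\<in>{1..m - 1}. U_pi2 n j =
            mat_from1 n (\<lambda>a b. 2 / of_nat n *
              of_real (cos (2 * (real a - real b) * real j * pi / real n))))"
proof -
  have m: "m > 0" using assms(1) by simp
  interpret D: isotypic_decomposition "dihedral n" n "perm_mat n" "{0..m}" "wave_dim m"
    "wave_mat m" "wave_dual m" "block_rep m"
    using dihedral_isotypic_decomposition[OF assms(1)] assms(2) by simp
  have MM: "MM n = D.alg" by (simp add: MM_def)
  have U: "U_triv n = D.U 0" "U_chi' n = D.U m" "\<And>j. j \<in> {1..m - 1} \<Longrightarrow> U_pi2 n j = D.U j"
    using U_triv_eq[OF m] U_chi'_eq[OF m] U_pi2_eq assms(2) by auto
  have "{0..m} = {0, m} \<union> {1..m - 1}" using m by auto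
  then have E: "{U_triv n, U_chi' n} \<union> U_pi2 n ` {1..m - 1} = D.U ` {0..m}"
    using U by (simp add: image_Un)
  have corr: "corresponds_to n (D.U j) (wave_dim m j) (block_rep m j)" if "j \<in> {0..m}" for j
    unfolding corresponds_to_def MM
    using D.irreducible_\<rho>[OF that] D.block_iso_Hom[OF that] by blast
  have "corresponds_to n (U_triv n) 1 (char_rep chi_triv)"
    using corr[of 0] U by (simp add: wave_dim_def block_rep_def)
  moreover have "corresponds_to n (U_chi' n) 1 (char_rep (chi_prime m))"
    using corr[of m] U m by (simp add: wave_dim_def block_rep_def)
  moreover have "corresponds_to n (U_pi2 n j) 2 (pi2_pow n j)" if "j \<in> {1..m - 1}" for j
  proof -
    have "j \<in> {0..m}" "j \<noteq> 0" "j \<noteq> m" using that m by auto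
    then show ?thesis
      using corr[of j] U(3)[OF that] assms(2) by (simp add: wave_dim_def block_rep_def)
  qed
  moreover have "card ({U_triv n, U_chi' n} \<union> U_pi2 n ` {1..m - 1}) = m + 1"
    unfolding E using card_image[OF D.inj_on_U] by simp
  moreover have "complete_orthogonal_idempotents (MM n) ({U_triv n, U_chi' n} \<union> U_pi2 n ` {1..m - 1})"
    unfolding E MM by (rule D.complete_orthogonal_idempotents_U)
  moreover have "U_pi2 n j = mat_from1 n (\<lambda>a b. 2 / of_nat n *
      of_real (cos (2 * (real a - real b) * real j * pi / real n)))" for j
    using U_pi2_entries[of n j]
    by (intro eq_matI) (auto simp: mat_from1_def mult_ac)
  ultimately show ?thesis by blast
qed

end
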